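(* Let $(M,\omega)$ be a Hamiltonian $G$-space. Let $*$ and $*'$ be two $G$-invariant star products on $N[[\lambda]]$ and let $\Phi_*$ and $\Phi_{*'}$ be the corresponding quantum moment maps. Assume that there exists an equivalence $T$ between $*$ and $*'$ such that $$T\Phi_*(X)=\Phi_{*'}(X)\quad\text{for all }X\in\mathfrak g.$$ Then $T$ is $G$-invariant; hence $*$ and $*'$ are formally $G$-equivalent.
   Context: $G$ is a Lie group with finite-dimensional Lie algebra $\mathfrak g$; a Hamiltonian $G$-space is a symplectic manifold with a Hamiltonian $G$-action admitting a moment map. $N=C^\infty(M)$ (complex valued), with Poisson bracket $\{\cdot,\cdot\}$. $G$ acts on $N[[\lambda]]$ by the action on functions induced from its action on $M$, and $u\mapsto Xu$ ($X\in\mathfrak g$) is the infinitesimal action. A star product is an associative $\mathbb C[[\lambda]]$-bilinear product on $N[[\lambda]]$ of the form $f*g=\sum_{n\ge0}(\lambda/2)^nC_n(f,g)$ for $f,g\in N$, with $C_0(f,g)=fg$, $C_1(f,g)-C_1(g,f)=2\{f,g\}$, $C_k(1,f)=C_k(f,1)=0$ for $k\ge1$, and each $C_k$ a bidifferential operator. It is $G$-invariant if $g(u*v)=gu*gv$ for all $u,v\in N[[\lambda]]$, $g\in G$. An equivalence between star products $*$ and $*'$ is a formal series $T=\mathrm{Id}+\sum_{n\ge1}\lambda^nT_n$ of differential operators annihilating constants with $f*'g=T(T^{-1}f*T^{-1}g)$. $T$ is $G$-invariant if it commutes with the $G$-action on $N[[\lambda]]$; $G$-invariant star products are (formally) $G$-equivalent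 if there is a $G$-invariant equivalence between them. $\mathfrak g_\lambda$ is $\mathfrak g[[\lambda]]$ with $\lambda$-linear bracket determined by $[\xi,\eta]_\lambda=\lambda[\xi,\eta]$ for $\xi,\eta\in\mathfrak g$, and $\mathfrak U(\mathfrak g_\lambda)$ is its universal enveloping algebra. A quantum moment map of a $G$-invariant star product $*$ is a homomorphism of associative algebras $\Phi_*:\mathfrak U(\mathfrak g_\lambda)\to(N[[\lambda]],* )$ with $[\Phi_*(X),u]_*=\lambda Xu$ for all $X\in\mathfrak g$, $u\in N[[\lambda]]$, where $[a,b]_*=a*b-b*a$.
   Formalization: The Lie group G is additionally assumed connected; without this the claim fails (e.g. G={±1} acting by −1 on R² with the Moyal product and T=exp(λ∂_p)). M and G are taken of positive dimension, the remaining cases being trivial. *)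

theory Defs
  imports
    "HOL-Analysis.Analysis"
    "HOL-Algebra.QuotRing"
    "HOL-Algebra.Group_Action"
    "HOL-Library.Function_Algebras"
    "HOL-Computational_Algebra.Formal_Power_Series"
begin

section \<open>Smooth maps on open sets\<close>

primrec Ck_on ::
  "nat \<Rightarrow> 'a::real_normed_vector set \<Rightarrow> ('a \<Rightarrow> 'b::real_normed_vector) \<Rightarrow> bool" where
  "Ck_on 0 S f \<longleftrightarrow> continuous_on S f"
| "Ck_on (Suc k) S f \<longleftrightarrow>
     (\<forall>x\<in>S. f differentiable (at x)) \<and>
     (\<forall>v. Ck_on k S (\<lambda>x. frechet_derivative f (at x) v))"

definition smooth_on ::
  "'a::real_normed_vector set \<Rightarrow> ('a \<Rightarrow> 'b::real_normed_vector) \<Rightarrow> bool" where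
  "smooth_on S f \<longleftrightarrow> (\<forall>k. Ck_on k S f)"

text \<open>\<open>iter_deriv [b\<^sub>1, \<dots>, b\<^sub>k] f\<close> is \<open>\<partial>\<^bsub>b\<^sub>1\<^esub> \<dots> \<partial>\<^bsub>b\<^sub>k\<^esub> f\<close>.\<close>

definition iter_deriv ::
  "'a::real_normed_vector list \<Rightarrow> ('a \<Rightarrow> 'b::real_normed_vector) \<Rightarrow> 'a \<Rightarrow> 'b" where
  "iter_deriv I f = foldr (\<lambda>b h x. frechet_derivative h (at x) b) I f"


section \<open>Smooth manifolds\<close>

text \<open>
  The underlying space of a manifold is a type; the Hausdorff property and second countability are
  type class constraints. A chart is a pair of its domain and its coordinate map, and the smooth
  structure is the one generated by a (not necessarily maximal) atlas.
\<close>

type_synonym ('m, 'e) atlas = "('m set \<times> ('m \<Rightarrow> 'e)) set"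

definition smooth_atlas ::
  "('m::{t2_space, second_countable_topology}, 'e::euclidean_space) atlas \<Rightarrow> bool" where
  "smooth_atlas A \<longleftrightarrow>
     (\<Union>(U, \<phi>)\<in>A. U) = UNIV \<and>
     (\<forall>(U, \<phi>)\<in>A. open U \<and> open (\<phi> ` U) \<and> homeomorphism U (\<phi> ` U) \<phi> (inv_into U \<phi>)) \<and>
     (\<forall>(U, \<phi>)\<in>A. \<forall>(V, \<psi>)\<in>A. smooth_on (\<phi> ` (U \<inter> V)) (\<psi> \<circ> inv_into U \<phi>))"

definition smooth_fun ::
  "('m, 'e::euclidean_space) atlas \<Rightarrow> ('m \<Rightarrow> 'b::real_normed_vector) \<Rightarrow> bool" where
  "smooth_fun A f \<longleftrightarrow> (\<forall>(U, \<phi>)\<in>A. smooth_on (\<phi> ` U) (f \<circ> inv_into U \<phi>))"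

definition smooth_map ::
  "('m::topological_space, 'e::euclidean_space) atlas \<Rightarrow>
   ('n::topological_space, 'd::euclidean_space) atlas \<Rightarrow> ('m \<Rightarrow> 'n) \<Rightarrow> bool" where
  "smooth_map A B F \<longleftrightarrow>
     continuous_on UNIV F \<and>
     (\<forall>(U, \<phi>)\<in>A. \<forall>(V, \<psi>)\<in>B. smooth_on (\<phi> ` (U \<inter> F -` V)) (\<psi> \<circ> F \<circ> inv_into U \<phi>))"

definition prod_atlas ::
  "('m, 'e) atlas \<Rightarrow> ('n, 'd) atlas \<Rightarrow> ('m \<times> 'n, 'e \<times> 'd) atlas" where
  "prod_atlas A B = (\<lambda>((U, \<phi>), (V, \<psi>)). (U \<times> V, map_prod \<phi> \<psi>)) ` (A \<times> B)"


section \<open>Tangent vectors and vector fields\<close>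

text \<open>
  Tangent vectors at a point are the derivations of \<open>C\<^sup>\<infinity>(M, \<real>)\<close> at that point. They are made
  unique as HOL functions by the value 0 on functions that are not smooth.
\<close>

type_synonym 'm tangent = "('m \<Rightarrow> real) \<Rightarrow> real"
type_synonym 'm vfield = "'m \<Rightarrow> 'm tangent"

definition tangent_space :: "('m, 'e::euclidean_space) atlas \<Rightarrow> 'm \<Rightarrow> 'm tangent set" where
  "tangent_space A p = {v.
     (\<forall>f g a b. smooth_fun A f \<longrightarrow> smooth_fun A g \<longrightarrow>
        v (\<lambda>q. a * f q + b * g q) = a * v f + b * v g) \<and>
     (\<forall>f g. smooth_fun A f \<longrightarrow> smooth_fun A g \<longrightarrow>
        v (\<lambda>q. f q * g q) = v f * g p + f p * v g) \<and>
     (\<forall>f. \<not> smooth_fun A f \<longrightarrow> v f = 0)}"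

definition pushforward ::
  "('n, 'd::euclidean_space) atlas \<Rightarrow> ('m \<Rightarrow> 'n) \<Rightarrow> 'm tangent \<Rightarrow> 'n tangent" where
  "pushforward B F v = (\<lambda>f. if smooth_fun B f then v (f \<circ> F) else 0)"

definition vector_field :: "('m, 'e::euclidean_space) atlas \<Rightarrow> 'm vfield \<Rightarrow> bool" where
  "vector_field A X \<longleftrightarrow>
     (\<forall>p. X p \<in> tangent_space A p) \<and>
     (\<forall>f. smooth_fun A f \<longrightarrow> smooth_fun A (\<lambda>p. X p f))"

definition vf_bracket ::
  "('m, 'e::euclidean_space) atlas \<Rightarrow> 'm vfield \<Rightarrow> 'm vfield \<Rightarrow> 'm vfield" where
  "vf_bracket A X Y = (\<lambda>p f.
     if smooth_fun A f then X p (\<lambda>q. Y q f) - Y p (\<lambda>q. X q f) else 0)"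

definition vf_scale :: "real \<Rightarrow> 'm vfield \<Rightarrow> 'm vfield" where
  "vf_scale a X = (\<lambda>p f. a * X p f)"

text \<open>The derivative of a complex valued function along a (real) tangent vector.\<close>

definition cderiv :: "'m tangent \<Rightarrow> ('m \<Rightarrow> complex) \<Rightarrow> complex" where
  "cderiv v u = Complex (v (Re \<circ> u)) (v (Im \<circ> u))"


section \<open>Lie groups and actions\<close>

definition lie_group ::
  "('g::{t2_space, second_countable_topology}, 'd::euclidean_space) atlas \<Rightarrow> 'g monoid \<Rightarrow> bool"
  where
  "lie_group A G \<longleftrightarrow>
     smooth_atlas A \<and> group G \<and> carrier G = UNIV \<and>
     smooth_map (prod_atlas A A) A (\<lambda>(g, h). g \<otimes>\<^bsub>G\<^esub> h) \<and>
     smooth_map A A (\<lambda>g. inv\<^bsub>G\<^esub> g)"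

definition lie_algebra ::
  "('g, 'd::euclidean_space) atlas \<Rightarrow> 'g monoid \<Rightarrow> 'g vfield set" where
  "lie_algebra A G = {X. vector_field A X \<and>
     (\<forall>g h. pushforward A (\<lambda>q. g \<otimes>\<^bsub>G\<^esub> q) (X h) = X (g \<otimes>\<^bsub>G\<^esub> h))}"

text \<open>
  The adjoint action is conjugation; on a left invariant field it is the push-forward under
  right translation by the inverse of \<open>g\<close>.
\<close>

definition Ad ::
  "('g, 'd::euclidean_space) atlas \<Rightarrow> 'g monoid \<Rightarrow> 'g \<Rightarrow> 'g vfield \<Rightarrow> 'g vfield" where
  "Ad A G g X = (\<lambda>h. pushforward A (\<lambda>q. q \<otimes>\<^bsub>G\<^esub> inv\<^bsub>G\<^esub> g) (X (h \<otimes>\<^bsub>G\<^esub> g)))"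

definition smooth_action ::
  "('g::{t2_space, second_countable_topology}, 'd::euclidean_space) atlas \<Rightarrow> 'g monoid \<Rightarrow>
   ('m::{t2_space, second_countable_topology}, 'e::euclidean_space) atlas \<Rightarrow>
   ('g \<Rightarrow> 'm \<Rightarrow> 'm) \<Rightarrow> bool" where
  "smooth_action AG G AM act \<longleftrightarrow>
     group_action G UNIV act \<and> smooth_map (prod_atlas AG AM) AM (\<lambda>(g, p). act g p)"

text \<open>The velocity at \<open>t = 0\<close> of \<open>exp (t X) \<cdot> p\<close>.\<close>

definition fundamental_field ::
  "'g monoid \<Rightarrow> ('m, 'e::euclidean_space) atlas \<Rightarrow> ('g \<Rightarrow> 'm \<Rightarrow> 'm) \<Rightarrow> 'g vfield \<Rightarrow> 'm vfield" where
  "fundamental_field G AM act X = (\<lambda>p. pushforward AM (\<lambda>g. act g p) (X \<one>\<^bsub>G\<^esub>))"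

definition act_fun :: "'g monoid \<Rightarrow> ('g \<Rightarrow> 'm \<Rightarrow> 'm) \<Rightarrow> 'g \<Rightarrow> ('m \<Rightarrow> 'b) \<Rightarrow> 'm \<Rightarrow> 'b" where
  "act_fun G act g u = (\<lambda>p. u (act (inv\<^bsub>G\<^esub> g) p))"

text \<open>The derivative of \<open>g \<mapsto> g u\<close> at the unit in the direction \<open>X\<close>.\<close>

definition inf_act ::
  "'g monoid \<Rightarrow> ('g \<Rightarrow> 'm \<Rightarrow> 'm) \<Rightarrow> 'g vfield \<Rightarrow> ('m \<Rightarrow> complex) \<Rightarrow> 'm \<Rightarrow> complex" where
  "inf_act G act X u = (\<lambda>p. cderiv (X \<one>\<^bsub>G\<^esub>) (\<lambda>g. act_fun G act g u p))"


section \<open>Symplectic manifolds and Hamiltonian spaces\<close>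

type_synonym 'm two_form = "'m \<Rightarrow> 'm tangent \<Rightarrow> 'm tangent \<Rightarrow> real"

definition symplectic_form :: "('m, 'e::euclidean_space) atlas \<Rightarrow> 'm two_form \<Rightarrow> bool" where
  "symplectic_form A \<omega> \<longleftrightarrow>
     (\<forall>p. \<forall>u\<in>tangent_space A p. \<forall>v\<in>tangent_space A p. \<forall>w\<in>tangent_space A p. \<forall>a b.
        \<omega> p (\<lambda>f. a * u f + b * v f) w = a * \<omega> p u w + b * \<omega> p v w) \<and>
     (\<forall>p. \<forall>v\<in>tangent_space A p. \<forall>w\<in>tangent_space A p. \<omega> p v w = - \<omega> p w v) \<and>
     (\<forall>p. \<forall>v\<in>tangent_space A p. (\<forall>w\<in>tangent_space A p. \<omega> p v w = 0) \<longrightarrow> v = 0) \<and>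
     (\<forall>X Y. vector_field A X \<longrightarrow> vector_field A Y \<longrightarrow> smooth_fun A (\<lambda>p. \<omega> p (X p) (Y p))) \<and>
     (\<forall>X Y Z. vector_field A X \<longrightarrow> vector_field A Y \<longrightarrow> vector_field A Z \<longrightarrow> (\<forall>p.
          X p (\<lambda>q. \<omega> q (Y q) (Z q)) + Y p (\<lambda>q. \<omega> q (Z q) (X q)) + Z p (\<lambda>q. \<omega> q (X q) (Y q))
        - \<omega> p (vf_bracket A X Y p) (Z p) - \<omega> p (vf_bracket A Y Z p) (X p)
        - \<omega> p (vf_bracket A Z X p) (Y p) = 0))"

text \<open>
  Sign conventions: \<open>\<omega>(X\<^sub>f, \<cdot>) = df\<close> and \<open>{f, g} = \<omega>(X\<^sub>f, X\<^sub>g)\<close>, extended complex bilinearly.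
\<close>

definition ham_field ::
  "('m, 'e::euclidean_space) atlas \<Rightarrow> 'm two_form \<Rightarrow> ('m \<Rightarrow> real) \<Rightarrow> 'm vfield" where
  "ham_field A \<omega> f = (\<lambda>p. THE v. v \<in> tangent_space A p \<and> (\<forall>w\<in>tangent_space A p. \<omega> p v w = w f))"

definition poisson ::
  "('m, 'e::euclidean_space) atlas \<Rightarrow> 'm two_form \<Rightarrow>
   ('m \<Rightarrow> complex) \<Rightarrow> ('m \<Rightarrow> complex) \<Rightarrow> 'm \<Rightarrow> complex" where
  "poisson A \<omega> f g = (\<lambda>p.
     let B = (\<lambda>a b. \<omega> p (ham_field A \<omega> a p) (ham_field A \<omega> b p))
     in Complex (B (Re \<circ> f) (Re \<circ> g) - B (Im \<circ> f) (Im \<circ> g))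
                (B (Re \<circ> f) (Im \<circ> g) + B (Im \<circ> f) (Re \<circ> g)))"

text \<open>
  A moment map \<open>M \<rightarrow> \<gg>\<^sup>*\<close> is given by its components \<open>J X\<close>, \<open>X \<in> \<gg>\<close>. The last clause is
  equivariance for the coadjoint action.
\<close>

definition moment_map ::
  "('g, 'd::euclidean_space) atlas \<Rightarrow> 'g monoid \<Rightarrow> ('m, 'e::euclidean_space) atlas \<Rightarrow> 'm two_form \<Rightarrow>
   ('g \<Rightarrow> 'm \<Rightarrow> 'm) \<Rightarrow> ('g vfield \<Rightarrow> 'm \<Rightarrow> real) \<Rightarrow> bool" where
  "moment_map AG G AM \<omega> act J \<longleftrightarrow>
     (\<forall>X\<in>lie_algebra AG G. smooth_fun AM (J X)) \<and>
     (\<forall>X\<in>lie_algebra AG G. \<forall>Y\<in>lie_algebra AG G. \<forall>a b p.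
        J (vf_scale a X + vf_scale b Y) p = a * J X p + b * J Y p) \<and>
     (\<forall>X\<in>lie_algebra AG G. \<forall>p. \<forall>w\<in>tangent_space AM p.
        \<omega> p (fundamental_field G AM act X p) w = w (J X)) \<and>
     (\<forall>g. \<forall>X\<in>lie_algebra AG G. \<forall>p. J (Ad AG G g X) (act g p) = J X p)"

definition hamiltonian_space ::
  "('g::{t2_space, second_countable_topology}, 'd::euclidean_space) atlas \<Rightarrow> 'g monoid \<Rightarrow>
   ('m::{t2_space, second_countable_topology}, 'e::euclidean_space) atlas \<Rightarrow> 'm two_form \<Rightarrow>
   ('g \<Rightarrow> 'm \<Rightarrow> 'm) \<Rightarrow> bool" where
  "hamiltonian_space AG G AM \<omega> act \<longleftrightarrow>
     smooth_atlas AM \<and> symplectic_form AM \<omega> \<and> smooth_action AG G AM act \<and>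
     (\<forall>g p. \<forall>v\<in>tangent_space AM p. \<forall>w\<in>tangent_space AM p.
        \<omega> (act g p) (pushforward AM (act g) v) (pushforward AM (act g) w) = \<omega> p v w) \<and>
     (\<exists>J. moment_map AG G AM \<omega> act J)"


section \<open>Differential operators on complex valued functions\<close>

text \<open>
  Operators of order at most \<open>k\<close>: in every chart a linear combination, with smooth coefficients,
  of the partial derivatives of order at most \<open>k\<close>. Partial derivatives are indexed by lists of
  basis vectors instead of multi-indices.
\<close>

definition basis_words :: "nat \<Rightarrow> 'e::euclidean_space list set" where
  "basis_words k = {I. set I \<subseteq> Basis \<and> length I \<le> k}"

definition diff_op ::
  "('m, 'e::euclidean_space) atlas \<Rightarrow> (('m \<Rightarrow> complex) \<Rightarrow> 'm \<Rightarrow> complex) \<Rightarrow> bool" where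
  "diff_op A D \<longleftrightarrow> (\<exists>k. \<forall>(U, \<phi>)\<in>A. \<exists>a.
     (\<forall>I\<in>basis_words k. smooth_on (\<phi> ` U) (a I)) \<and>
     (\<forall>f. smooth_fun A f \<longrightarrow> (\<forall>p\<in>U.
        D f p = (\<Sum>I\<in>basis_words k. a I (\<phi> p) * iter_deriv I (f \<circ> inv_into U \<phi>) (\<phi> p)))))"

definition bidiff_op ::
  "('m, 'e::euclidean_space) atlas \<Rightarrow>
   (('m \<Rightarrow> complex) \<Rightarrow> ('m \<Rightarrow> complex) \<Rightarrow> 'm \<Rightarrow> complex) \<Rightarrow> bool" where
  "bidiff_op A C \<longleftrightarrow> (\<exists>k. \<forall>(U, \<phi>)\<in>A. \<exists>a.
     (\<forall>I\<in>basis_words k. \<forall>J\<in>basis_words k. smooth_on (\<phi> ` U) (a I J)) \<and>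
     (\<forall>f g. smooth_fun A f \<longrightarrow> smooth_fun A g \<longrightarrow> (\<forall>p\<in>U.
        C f g p = (\<Sum>I\<in>basis_words k. \<Sum>J\<in>basis_words k.
          a I J (\<phi> p) * iter_deriv I (f \<circ> inv_into U \<phi>) (\<phi> p)
                     * iter_deriv J (g \<circ> inv_into U \<phi>) (\<phi> p)))))"


section \<open>Formal power series\<close>

text \<open>The action of scalar series on vector series, extending a scalar multiplication \<open>sc\<close>.\<close>

definition fps_scale ::
  "('k \<Rightarrow> 'v \<Rightarrow> 'v::comm_monoid_add) \<Rightarrow> 'k fps \<Rightarrow> 'v fps \<Rightarrow> 'v fps" where
  "fps_scale sc c u = Abs_fps (\<lambda>n. \<Sum>i\<le>n. sc (fps_nth c i) (fps_nth u (n - i)))"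

definition fps_map :: "('a \<Rightarrow> 'b) \<Rightarrow> 'a fps \<Rightarrow> 'b fps" where
  "fps_map F u = Abs_fps (\<lambda>n. F (fps_nth u n))"

definition fun_scale :: "complex \<Rightarrow> ('m \<Rightarrow> complex) \<Rightarrow> 'm \<Rightarrow> complex" where
  "fun_scale a f = (\<lambda>p. a * f p)"

abbreviation cscale :: "complex fps \<Rightarrow> ('m \<Rightarrow> complex) fps \<Rightarrow> ('m \<Rightarrow> complex) fps" where
  "cscale \<equiv> fps_scale fun_scale"

abbreviation rscale :: "real fps \<Rightarrow> ('m \<Rightarrow> complex) fps \<Rightarrow> ('m \<Rightarrow> complex) fps" where
  "rscale \<equiv> fps_scale (\<lambda>a. fun_scale (complex_of_real a))"

text \<open>\<open>N[[\<lambda>]]\<close>; the formal parameter \<open>\<lambda>\<close> is \<^const>\<open>fps_X\<close>.\<close>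

definition formal_funs :: "('m, 'e::euclidean_space) atlas \<Rightarrow> ('m \<Rightarrow> complex) fps set" where
  "formal_funs A = {u. \<forall>n. smooth_fun A (fps_nth u n)}"

definition act_fps :: "'g monoid \<Rightarrow> ('g \<Rightarrow> 'm \<Rightarrow> 'm) \<Rightarrow> 'g \<Rightarrow> ('m \<Rightarrow> complex) fps \<Rightarrow> ('m \<Rightarrow> complex) fps"
  where "act_fps G act g = fps_map (act_fun G act g)"


section \<open>Star products and equivalences\<close>

type_synonym 'm product =
  "('m \<Rightarrow> complex) fps \<Rightarrow> ('m \<Rightarrow> complex) fps \<Rightarrow> ('m \<Rightarrow> complex) fps"

definition star_product ::
  "('m, 'e::euclidean_space) atlas \<Rightarrow> 'm two_form \<Rightarrow> 'm product \<Rightarrow> bool" where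
  "star_product A \<omega> star \<longleftrightarrow>
     (\<forall>u\<in>formal_funs A. \<forall>v\<in>formal_funs A. star u v \<in> formal_funs A) \<and>
     (\<forall>u\<in>formal_funs A. \<forall>v\<in>formal_funs A. \<forall>w\<in>formal_funs A.
        star (star u v) w = star u (star v w) \<and>
        star (u + v) w = star u w + star v w \<and>
        star w (u + v) = star w u + star w v) \<and>
     (\<forall>c. \<forall>u\<in>formal_funs A. \<forall>v\<in>formal_funs A.
        star (cscale c u) v = cscale c (star u v) \<and>
        star u (cscale c v) = cscale c (star u v)) \<and>
     (\<exists>C. (\<forall>n. bidiff_op A (C n)) \<and>
        (\<forall>f g. smooth_fun A f \<longrightarrow> smooth_fun A g \<longrightarrow>
           star (fps_const f) (fps_const g) = Abs_fps (\<lambda>n. fun_scale ((1 / 2) ^ n) (C n f g)) \<and>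
           C 0 f g = f * g \<and>
           C 1 f g - C 1 g f = fun_scale 2 (poisson A \<omega> f g)) \<and>
        (\<forall>k\<ge>1. \<forall>f. smooth_fun A f \<longrightarrow> C k 1 f = 0 \<and> C k f 1 = 0))"

definition invariant_product ::
  "'g monoid \<Rightarrow> ('m, 'e::euclidean_space) atlas \<Rightarrow> ('g \<Rightarrow> 'm \<Rightarrow> 'm) \<Rightarrow> 'm product \<Rightarrow> bool" where
  "invariant_product G A act star \<longleftrightarrow>
     (\<forall>g. \<forall>u\<in>formal_funs A. \<forall>v\<in>formal_funs A.
        act_fps G act g (star u v) = star (act_fps G act g u) (act_fps G act g v))"

text \<open>A sequence \<open>T\<close> of operators stands for the formal series \<open>\<Sum>n. \<lambda>\<^sup>n T\<^sub>n\<close>.\<close>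

type_synonym 'm op_series = "nat \<Rightarrow> ('m \<Rightarrow> complex) \<Rightarrow> 'm \<Rightarrow> complex"

definition op_apply :: "'m op_series \<Rightarrow> ('m \<Rightarrow> complex) fps \<Rightarrow> ('m \<Rightarrow> complex) fps" where
  "op_apply T u = Abs_fps (\<lambda>n. \<Sum>i\<le>n. T i (fps_nth u (n - i)))"

definition star_equivalence ::
  "('m, 'e::euclidean_space) atlas \<Rightarrow> 'm product \<Rightarrow> 'm product \<Rightarrow> 'm op_series \<Rightarrow> bool" where
  "star_equivalence A star star' T \<longleftrightarrow>
     (\<forall>f. smooth_fun A f \<longrightarrow> T 0 f = f) \<and>
     (\<forall>n\<ge>1. diff_op A (T n) \<and> (\<forall>c. T n (\<lambda>_. c) = 0)) \<and>
     (\<forall>f\<in>formal_funs A. \<forall>g\<in>formal_funs A.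
        star' f g = op_apply T (star (inv_into (formal_funs A) (op_apply T) f)
                                     (inv_into (formal_funs A) (op_apply T) g)))"

definition invariant_op ::
  "'g monoid \<Rightarrow> ('m, 'e::euclidean_space) atlas \<Rightarrow> ('g \<Rightarrow> 'm \<Rightarrow> 'm) \<Rightarrow> 'm op_series \<Rightarrow> bool" where
  "invariant_op G A act T \<longleftrightarrow>
     (\<forall>g. \<forall>u\<in>formal_funs A. op_apply T (act_fps G act g u) = act_fps G act g (op_apply T u))"

definition G_equivalent ::
  "'g monoid \<Rightarrow> ('m, 'e::euclidean_space) atlas \<Rightarrow> ('g \<Rightarrow> 'm \<Rightarrow> 'm) \<Rightarrow>
   'm product \<Rightarrow> 'm product \<Rightarrow> bool" where
  "G_equivalent G A act star star' \<longleftrightarrow>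
     (\<exists>T. star_equivalence A star star' T \<and> invariant_op G A act T)"


section \<open>Universal enveloping algebras\<close>

text \<open>
  The free associative algebra on a set \<open>L\<close>: finitely supported functions on words over \<open>L\<close>.
  Imposing linearity of \<open>x \<mapsto> [x]\<close> turns it into the tensor algebra of \<open>L\<close>, and imposing in
  addition \<open>x \<otimes> y - y \<otimes> x = [x, y]\<close> gives the universal enveloping algebra.
\<close>

definition free_algebra :: "'l set \<Rightarrow> ('l list \<Rightarrow> 'k::comm_ring_1) ring" where
  "free_algebra L = \<lparr>
     carrier = {a. finite {w. a w \<noteq> 0} \<and> {w. a w \<noteq> 0} \<subseteq> lists L},
     mult = (\<lambda>a b w. \<Sum>i\<le>length w. a (take i w) * b (drop i w)),
     one = (\<lambda>w. if w = [] then 1 else 0),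
     zero = (\<lambda>w. 0),
     add = (\<lambda>a b w. a w + b w)\<rparr>"

definition word_elem :: "'l list \<Rightarrow> 'l list \<Rightarrow> 'k::comm_ring_1" where
  "word_elem v = (\<lambda>w. if w = v then 1 else 0)"

definition env_ideal ::
  "'l::ab_group_add set \<Rightarrow> ('k::comm_ring_1 \<Rightarrow> 'l \<Rightarrow> 'l) \<Rightarrow> ('l \<Rightarrow> 'l \<Rightarrow> 'l) \<Rightarrow> ('l list \<Rightarrow> 'k) set"
  where
  "env_ideal L sc br = genideal (free_algebra L)
     ({word_elem [x + y] - word_elem [x] - word_elem [y] | x y. x \<in> L \<and> y \<in> L} \<union>
      {word_elem [sc c x] - (\<lambda>w. c * word_elem [x] w) | c x. x \<in> L} \<union>
      {word_elem [x, y] - word_elem [y, x] - word_elem [br x y] | x y. x \<in> L \<and> y \<in> L})"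

definition env_algebra ::
  "'l::ab_group_add set \<Rightarrow> ('k::comm_ring_1 \<Rightarrow> 'l \<Rightarrow> 'l) \<Rightarrow> ('l \<Rightarrow> 'l \<Rightarrow> 'l) \<Rightarrow> ('l list \<Rightarrow> 'k) set ring"
  where
  "env_algebra L sc br = free_algebra L Quot env_ideal L sc br"

definition env_class ::
  "'l::ab_group_add set \<Rightarrow> ('k::comm_ring_1 \<Rightarrow> 'l \<Rightarrow> 'l) \<Rightarrow> ('l \<Rightarrow> 'l \<Rightarrow> 'l) \<Rightarrow>
   ('l list \<Rightarrow> 'k) \<Rightarrow> ('l list \<Rightarrow> 'k) set" where
  "env_class L sc br a = env_ideal L sc br +>\<^bsub>free_algebra L\<^esub> a"


section \<open>Quantum moment maps\<close>

text \<open>\<open>\<gg>\<^sub>\<lambda>\<close> as a Lie algebra over \<open>\<real>[[\<lambda>]]\<close>, with \<open>[\<xi>, \<eta>]\<^sub>\<lambda> = \<lambda> [\<xi>, \<eta>]\<close>.\<close>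

definition formal_lie_algebra ::
  "('g, 'd::euclidean_space) atlas \<Rightarrow> 'g monoid \<Rightarrow> 'g vfield fps set" where
  "formal_lie_algebra A G = {\<xi>. \<forall>n. fps_nth \<xi> n \<in> lie_algebra A G}"

definition formal_bracket ::
  "('g, 'd::euclidean_space) atlas \<Rightarrow> 'g vfield fps \<Rightarrow> 'g vfield fps \<Rightarrow> 'g vfield fps" where
  "formal_bracket A \<xi> \<eta> = Abs_fps (\<lambda>n. case n of 0 \<Rightarrow> 0
     | Suc m \<Rightarrow> (\<Sum>i\<le>m. vf_bracket A (fps_nth \<xi> i) (fps_nth \<eta> (m - i))))"

type_synonym 'g env = "('g vfield fps list \<Rightarrow> real fps) set"

definition U_lambda :: "('g, 'd::euclidean_space) atlas \<Rightarrow> 'g monoid \<Rightarrow> 'g env ring" where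
  "U_lambda A G = env_algebra (formal_lie_algebra A G) (fps_scale vf_scale) (formal_bracket A)"

definition U_class ::
  "('g, 'd::euclidean_space) atlas \<Rightarrow> 'g monoid \<Rightarrow> ('g vfield fps list \<Rightarrow> real fps) \<Rightarrow> 'g env" where
  "U_class A G = env_class (formal_lie_algebra A G) (fps_scale vf_scale) (formal_bracket A)"

text \<open>The image in \<open>\<UU>(\<gg>\<^sub>\<lambda>)\<close> of an element of \<open>\<gg>\<close> and of a scalar.\<close>

definition U_gen :: "('g, 'd::euclidean_space) atlas \<Rightarrow> 'g monoid \<Rightarrow> 'g vfield \<Rightarrow> 'g env" where
  "U_gen A G X = U_class A G (word_elem [fps_const X])"

definition U_scalar :: "('g, 'd::euclidean_space) atlas \<Rightarrow> 'g monoid \<Rightarrow> real fps \<Rightarrow> 'g env" where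
  "U_scalar A G c = U_class A G (\<lambda>w. c * word_elem [] w)"

definition star_ring ::
  "('m, 'e::euclidean_space) atlas \<Rightarrow> 'm product \<Rightarrow> ('m \<Rightarrow> complex) fps ring" where
  "star_ring A star = \<lparr>carrier = formal_funs A, mult = star, one = fps_const 1, zero = 0, add = (+)\<rparr>"

definition quantum_moment_map ::
  "('g, 'd::euclidean_space) atlas \<Rightarrow> 'g monoid \<Rightarrow> ('m, 'e::euclidean_space) atlas \<Rightarrow>
   ('g \<Rightarrow> 'm \<Rightarrow> 'm) \<Rightarrow> 'm product \<Rightarrow> ('g env \<Rightarrow> ('m \<Rightarrow> complex) fps) \<Rightarrow> bool" where
  "quantum_moment_map AG G AM act star \<Phi> \<longleftrightarrow>
     \<Phi> \<in> ring_hom (U_lambda AG G) (star_ring AM star) \<and>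
     (\<forall>c. \<forall>x\<in>carrier (U_lambda AG G).
        \<Phi> (U_scalar AG G c \<otimes>\<^bsub>U_lambda AG G\<^esub> x) = rscale c (\<Phi> x)) \<and>
     (\<forall>X\<in>lie_algebra AG G. \<forall>u\<in>formal_funs AM.
        star (\<Phi> (U_gen AG G X)) u - star u (\<Phi> (U_gen AG G X)) =
        cscale fps_X (fps_map (inf_act G act X) u))"

end

theory Submission
  imports Defs
begin

text \<open>
  Applying \<open>T\<close> to \<open>[\<Phi>\<^sub>*(X), f]\<^sub>* = \<lambda> X f\<close> and comparing coefficients shows that every \<open>T\<^sub>n\<close>
  commutes with the infinitesimal action. To integrate this over the connected group without
  exponential map or flows, consider \<open>F(g) = (T\<^sub>n (g u))(g p)\<close>. Near \<open>g\<close>, \<open>F\<close> is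
  \<open>h \<mapsto> (T\<^sub>n (h v))(h q)\<close> with \<open>v = g u\<close>, \<open>q = g p\<close> and \<open>h\<close> near the unit. Since \<open>T\<^sub>n\<close> is a
  differential operator, the derivative at the unit along \<open>X\<close> may be taken under \<open>T\<^sub>n\<close> and equals
  \<open>(T\<^sub>n (X v) - X (T\<^sub>n v))(q) = 0\<close>. Hence \<open>F\<close> is locally constant, so \<open>F(g) = F(1)\<close>, which is the
  invariance of \<open>T\<^sub>n\<close>.
\<close>

section \<open>Calculus of smooth maps\<close>

text \<open>The Lie algebra sees only the identity component, so it is connectedness that carries
  invariance from a neighbourhood of the unit to all of \<open>G\<close>. The derivative at the unit
  may pass under \<open>T n\<close> because in charts \<open>T n\<close> is a finite sum of
  coefficients times partial derivatives in the point y, applied to v(x^-1 y), which is jointly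
  smooth in (x, y); the exchange then amounts to symmetry of second derivatives. Since h enters both
  through the function and through the point, two partial derivatives appear. The one in the point
  carries a minus sign, because functions are moved by the inverse, and this is how the commutator
  with X arises. The tangent directions in question are the coordinate vectors at the unit: each
  extends to a left invariant field, and so the hypothesis on elements of the Lie algebra reaches
  every direction. Smoothness of X f is read off from the quantum moment map, as \<lambda> X f is a
  star commutator.\<close>

lemma Ck_on_cong:
  assumes "open S" "Ck_on k S f" "\<And>x. x \<in> S \<Longrightarrow> f x = g x"
  shows "Ck_on k S g"
  using assms(2,3)
proof (induction k arbitrary: f g)
  case 0
  then show ?case by (metis Ck_on.simps(1) continuous_on_cong)
next
  case (Suc k)
  have d: "f differentiable at x" if "x \<in> S" for x
    using Suc.prems(1) that by simp
  \<comment> \<open>Derivatives in \<open>Ck_on\<close> are taken in the full space, not within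
    \<open>S\<close>; openness of \<open>S\<close> makes them depend on the values on
    \<open>S\<close> alone.\<close>
  have "g differentiable at x" if "x \<in> S" for x
    using d[OF that] that assms(1) Suc.prems(2)
    unfolding differentiable_def by (meson has_derivative_transform_within_open)
  moreover have "Ck_on k S (\<lambda>x. frechet_derivative g (at x) v)" for v
  proof (rule Suc.IH)
    show "Ck_on k S (\<lambda>x. frechet_derivative f (at x) v)"
      using Suc.prems(1) by simp
    show "frechet_derivative f (at x) v = frechet_derivative g (at x) v" if "x \<in> S" for x
      using frechet_derivative_transform_within_open[OF d[OF that] assms(1) that Suc.prems(2)] by simp
  qed
  ultimately show ?case by simp
qed

lemma Ck_on_subset: "Ck_on k S f \<Longrightarrow> T \<subseteq> S \<Longrightarrow> Ck_on k T f"
  by (induction k arbitrary: f) (auto intro: continuous_on_subset)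

lemma Ck_on_SucD: "Ck_on (Suc k) S f \<Longrightarrow> Ck_on k S f"
proof (induction k arbitrary: f)
  case 0
  then show ?case
    by (auto intro!: continuous_at_imp_continuous_on differentiable_imp_continuous_within)
next
  case (Suc k)
  then show ?case
    using Ck_on.simps(2) by blast
qed

text \<open>A neighbourhood that serves \<open>f\<close> also serves its directional derivatives, so
  the induction can keep it. This allows the intermediate chart of a composition to change from
  point to point.\<close>

lemma Ck_on_local:
  assumes "\<And>x. x \<in> S \<Longrightarrow> \<exists>U. open U \<and> x \<in> U \<and> Ck_on k U f"
  shows "Ck_on k S f"
  using assms
proof (induction k arbitrary: f)
  case 0
  then show ?case
    by (metis Ck_on.simps(1) continuous_at_imp_continuous_on continuous_on_eq_continuous_at)
next
  case (Suc k)
  show ?case unfolding Ck_on.simps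
  proof (intro conjI allI ballI)
    show "f differentiable at x" if "x \<in> S" for x
      using Suc.prems[OF that] by auto
    show "Ck_on k S (\<lambda>x. frechet_derivative f (at x) v)" for v
      by (rule Suc.IH) (use Suc.prems in fastforce)
  qed
qed

lemma Ck_on_const: "Ck_on k S (\<lambda>x. c)"
  by (induction k arbitrary: c) auto

lemma Ck_on_bounded_linear:
  assumes "bounded_linear h"
  shows "Ck_on k S h"
proof (cases k)
  case 0
  then show ?thesis using assms linear_continuous_on by auto
next
  case (Suc m)
  have "frechet_derivative h (at x) = h" for x
    using assms bounded_linear_imp_has_derivative frechet_derivative_at by metis
  then show ?thesis
    using Suc assms by (simp add: Ck_on_const bounded_linear_imp_differentiable)
qed

lemma Ck_on_bounded_linear_comp:
  assumes "bounded_linear h" "open S" "Ck_on k S f"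
  shows "Ck_on k S (\<lambda>x. h (f x))"
  using assms(3)
proof (induction k arbitrary: f)
  case 0
  then show ?case
    by (simp add: assms(1) bounded_linear.continuous_on)
next
  case (Suc k)
  have d: "((\<lambda>x. h (f x)) has_derivative (\<lambda>v. h (frechet_derivative f (at x) v))) (at x)"
    if "x \<in> S" for x
    using Suc.prems that
    by (intro bounded_linear.has_derivative[OF assms(1)]) (simp add: frechet_derivative_works[symmetric])
  have e: "frechet_derivative (\<lambda>x. h (f x)) (at x) = (\<lambda>v. h (frechet_derivative f (at x) v))"
    if "x \<in> S" for x
    using frechet_derivative_at[OF d[OF that]] by simp
  have "Ck_on k S (\<lambda>x. frechet_derivative (\<lambda>x. h (f x)) (at x) v)" for v
    by (rule Ck_on_cong[OF assms(2) Suc.IH[of "\<lambda>x. frechet_derivative f (at x) v"]])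
      (use Suc.prems e in auto)
  then show ?case
    using d unfolding Ck_on.simps differentiable_def by blast
qed

lemma Ck_on_add:
  assumes "open S" "Ck_on k S f" "Ck_on k S g"
  shows "Ck_on k S (\<lambda>x. f x + g x)"
  using assms(2,3)
proof (induction k arbitrary: f g)
  case 0
  then show ?case by (simp add: continuous_on_add)
next
  case (Suc k)
  have d: "((\<lambda>x. f x + g x) has_derivative
      (\<lambda>v. frechet_derivative f (at x) v + frechet_derivative g (at x) v)) (at x)"
    if "x \<in> S" for x
    using Suc.prems that by (auto simp: frechet_derivative_works[symmetric] intro!: has_derivative_add)
  have e: "frechet_derivative (\<lambda>x. f x + g x) (at x) =
      (\<lambda>v. frechet_derivative f (at x) v + frechet_derivative g (at x) v)"
    if "x \<in> S" for x
    using frechet_derivative_at[OF d[OF that]] by simp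
  have "Ck_on k S (\<lambda>x. frechet_derivative (\<lambda>x. f x + g x) (at x) v)" for v
    by (rule Ck_on_cong[OF assms(1) Suc.IH[of "\<lambda>x. frechet_derivative f (at x) v"
            "\<lambda>x. frechet_derivative g (at x) v"]])
      (use Suc.prems e in auto)
  then show ?case
    using d unfolding Ck_on.simps differentiable_def by blast
qed

text \<open>An arbitrary bounded bilinear map covers both multiplication and scaling by reals. Each
  term of the product rule leaves one factor undifferentiated, so \<open>Ck_on_SucD\<close> has to
  lower that factor to level \<open>k\<close> before the induction hypothesis applies.\<close>

lemma Ck_on_bilinear:
  assumes "bounded_bilinear pr" "open S" "Ck_on k S f" "Ck_on k S g"
  shows "Ck_on k S (\<lambda>x. pr (f x) (g x))"
  using assms(3,4)
proof (induction k arbitrary: f g)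
  case 0
  then show ?case by (simp add: bounded_bilinear.continuous_on[OF assms(1)])
next
  case (Suc k)
  have d: "((\<lambda>x. pr (f x) (g x)) has_derivative
      (\<lambda>v. pr (f x) (frechet_derivative g (at x) v) + pr (frechet_derivative f (at x) v) (g x))) (at x)"
    if "x \<in> S" for x
    using Suc.prems that
    by (auto simp: frechet_derivative_works[symmetric] intro!: bounded_bilinear.FDERIV[OF assms(1)])
  have e: "frechet_derivative (\<lambda>x. pr (f x) (g x)) (at x) =
      (\<lambda>v. pr (f x) (frechet_derivative g (at x) v) + pr (frechet_derivative f (at x) v) (g x))"
    if "x \<in> S" for x
    using frechet_derivative_at[OF d[OF that]] by simp
  have "Ck_on k S (\<lambda>x. frechet_derivative (\<lambda>x. pr (f x) (g x)) (at x) v)" for v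
  proof (rule Ck_on_cong[OF assms(2)])
    show "Ck_on k S (\<lambda>x. pr (f x) (frechet_derivative g (at x) v)
        + pr (frechet_derivative f (at x) v) (g x))"
      using Suc.prems Ck_on_SucD[OF Suc.prems(1)] Ck_on_SucD[OF Suc.prems(2)]
      by (intro Ck_on_add[OF assms(2)] Suc.IH) auto
  qed (use e in auto)
  then show ?case
    using d unfolding Ck_on.simps differentiable_def by blast
qed

lemma Ck_on_sum:
  assumes "open S" "\<And>i. i \<in> I \<Longrightarrow> Ck_on k S (f i)"
  shows "Ck_on k S (\<lambda>x. \<Sum>i\<in>I. f i x)"
  using assms(2)
  by (induction I rule: infinite_finite_induct)
    (simp_all add: Ck_on_const Ck_on_add[OF assms(1)])

text \<open>\<open>Ck_on\<close> controls derivatives along fixed directions, but in the chain rule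
  the direction in which \<open>g\<close> is differentiated moves with the point. Expanding it in
  the basis of the intermediate space leaves fixed directions with varying coefficients, to which
  the product rule and the induction hypothesis apply.\<close>

lemma Ck_on_compose:
  fixes f :: "'a::real_normed_vector \<Rightarrow> 'b::euclidean_space" and g :: "'b \<Rightarrow> 'c::real_normed_vector"
  assumes "open S" "Ck_on k S f" "Ck_on k T g" "f ` S \<subseteq> T"
  shows "Ck_on k S (\<lambda>x. g (f x))"
  using assms(2,3)
proof (induction k arbitrary: g)
  case 0
  then show ?case
    using assms(4) continuous_on_compose2 by auto
next
  case (Suc k)
  have df: "(f has_derivative frechet_derivative f (at x)) (at x)" if "x \<in> S" for x
    using Suc.prems(1) that by (simp add: frechet_derivative_works[symmetric])
  have dg: "(g has_derivative frechet_derivative g (at (f x))) (at (f x))" if "x \<in> S" for x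
    using Suc.prems(2) that assms(4) by (auto simp: frechet_derivative_works[symmetric])
  have d: "((\<lambda>x. g (f x)) has_derivative
      (\<lambda>v. frechet_derivative g (at (f x)) (frechet_derivative f (at x) v))) (at x)"
    if "x \<in> S" for x
    using diff_chain_at[OF df[OF that] dg[OF that]] by (simp add: o_def)
  have e: "frechet_derivative (\<lambda>x. g (f x)) (at x) v =
      (\<Sum>b\<in>Basis. (frechet_derivative f (at x) v \<bullet> b) *\<^sub>R frechet_derivative g (at (f x)) b)"
    if "x \<in> S" for x v
  proof -
    have "frechet_derivative (\<lambda>x. g (f x)) (at x) v =
        frechet_derivative g (at (f x)) (frechet_derivative f (at x) v)"
      using frechet_derivative_at[OF d[OF that]] by metis
    also have "\<dots> = frechet_derivative g (at (f x))
        (\<Sum>b\<in>Basis. (frechet_derivative f (at x) v \<bullet> b) *\<^sub>R b)"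
      by (simp add: euclidean_representation)
    also have "\<dots> = (\<Sum>b\<in>Basis. (frechet_derivative f (at x) v \<bullet> b) *\<^sub>R frechet_derivative g (at (f x)) b)"
      using has_derivative_linear[OF dg[OF that]] by (simp add: linear_sum linear_cmul)
    finally show ?thesis .
  qed
  have "Ck_on k S (\<lambda>x. frechet_derivative (\<lambda>x. g (f x)) (at x) v)" for v
  proof (rule Ck_on_cong[OF assms(1)])
    show "Ck_on k S (\<lambda>x. \<Sum>b\<in>Basis. (frechet_derivative f (at x) v \<bullet> b) *\<^sub>R frechet_derivative g (at (f x)) b)"
      using Suc.prems Ck_on_SucD[OF Suc.prems(1)]
      by (intro Ck_on_sum Ck_on_bilinear[OF bounded_bilinear_scaleR] assms(1) Suc.IH
          Ck_on_bounded_linear_comp[OF bounded_linear_inner_left]) auto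
  qed (use e in auto)
  then show ?case
    using d unfolding Ck_on.simps differentiable_def by blast
qed

section \<open>Maps that are differentiable to all orders\<close>

lemma smooth_on_cong:
  "open S \<Longrightarrow> smooth_on S f \<Longrightarrow> (\<And>x. x \<in> S \<Longrightarrow> f x = g x) \<Longrightarrow> smooth_on S g"
  unfolding smooth_on_def using Ck_on_cong by blast

lemma smooth_on_subset: "smooth_on S f \<Longrightarrow> T \<subseteq> S \<Longrightarrow> smooth_on T f"
  unfolding smooth_on_def using Ck_on_subset by blast

lemma smooth_on_local:
  "(\<And>x. x \<in> S \<Longrightarrow> \<exists>U. open U \<and> x \<in> U \<and> smooth_on U f) \<Longrightarrow> smooth_on S f"
  unfolding smooth_on_def by (intro allI Ck_on_local) metis

lemma smooth_on_const: "smooth_on S (\<lambda>x. c)"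
  unfolding smooth_on_def using Ck_on_const by blast

lemma smooth_on_bounded_linear: "bounded_linear h \<Longrightarrow> smooth_on S h"
  unfolding smooth_on_def using Ck_on_bounded_linear by blast

lemma smooth_on_bounded_linear_comp:
  "bounded_linear h \<Longrightarrow> open S \<Longrightarrow> smooth_on S f \<Longrightarrow> smooth_on S (\<lambda>x. h (f x))"
  unfolding smooth_on_def using Ck_on_bounded_linear_comp by blast

lemma smooth_on_add:
  "open S \<Longrightarrow> smooth_on S f \<Longrightarrow> smooth_on S g \<Longrightarrow> smooth_on S (\<lambda>x. f x + g x)"
  unfolding smooth_on_def using Ck_on_add by blast

lemma smooth_on_mult:
  fixes f g :: "'a::real_normed_vector \<Rightarrow> 'b::real_normed_algebra"
  shows "open S \<Longrightarrow> smooth_on S f \<Longrightarrow> smooth_on S g \<Longrightarrow> smooth_on S (\<lambda>x. f x * g x)"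
  unfolding smooth_on_def using Ck_on_bilinear[OF bounded_bilinear_mult] by blast

lemma smooth_on_sum:
  "open S \<Longrightarrow> (\<And>i. i \<in> I \<Longrightarrow> smooth_on S (f i)) \<Longrightarrow> smooth_on S (\<lambda>x. \<Sum>i\<in>I. f i x)"
  unfolding smooth_on_def by (intro allI Ck_on_sum) auto

lemma smooth_on_Pair:
  assumes "open S" "smooth_on S f" "smooth_on S g"
  shows "smooth_on S (\<lambda>x. (f x, g x))"
proof -
  have "smooth_on S (\<lambda>x. (f x, 0))"
    using smooth_on_bounded_linear_comp[OF bounded_linear_Pair[OF bounded_linear_ident bounded_linear_zero]
        assms(1,2)] .
  moreover have "smooth_on S (\<lambda>x. (0, g x))"
    using smooth_on_bounded_linear_comp[OF bounded_linear_Pair[OF bounded_linear_zero bounded_linear_ident]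
        assms(1,3)] .
  ultimately show ?thesis
    using smooth_on_add[OF assms(1)] by fastforce
qed

lemma smooth_on_compose:
  fixes f :: "'a::real_normed_vector \<Rightarrow> 'b::euclidean_space" and g :: "'b \<Rightarrow> 'c::real_normed_vector"
  shows "open S \<Longrightarrow> smooth_on S f \<Longrightarrow> smooth_on T g \<Longrightarrow> f ` S \<subseteq> T \<Longrightarrow> smooth_on S (\<lambda>x. g (f x))"
  unfolding smooth_on_def using Ck_on_compose by blast

lemma smooth_on_continuous_on: "smooth_on S f \<Longrightarrow> continuous_on S f"
  unfolding smooth_on_def by (metis Ck_on.simps(1))

lemma smooth_on_has_derivative:
  "smooth_on S f \<Longrightarrow> x \<in> S \<Longrightarrow> (f has_derivative frechet_derivative f (at x)) (at x)"
  unfolding smooth_on_def by (meson Ck_on.simps(2) frechet_derivative_works)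

lemma smooth_on_frechet_derivative:
  "smooth_on S f \<Longrightarrow> smooth_on S (\<lambda>x. frechet_derivative f (at x) v)"
  unfolding smooth_on_def using Ck_on.simps(2) by blast

lemma frechet_derivative_cong:
  assumes "open S" "x \<in> S" "\<And>y. y \<in> S \<Longrightarrow> f y = g y" "smooth_on S f"
  shows "frechet_derivative f (at x) = frechet_derivative g (at x)"
  by (rule frechet_derivative_transform_within_open[of _ _ S])
    (use assms smooth_on_has_derivative[OF assms(4,2)] in \<open>auto simp: differentiable_def\<close>)

section \<open>Iterated directional derivatives\<close>

lemma iter_deriv_Nil [simp]: "iter_deriv [] f = f"
  by (simp add: iter_deriv_def)

lemma iter_deriv_Cons [simp]:
  "iter_deriv (b # I) f = (\<lambda>x. frechet_derivative (iter_deriv I f) (at x) b)"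
  by (simp add: iter_deriv_def)

lemma smooth_on_iter_deriv: "smooth_on S f \<Longrightarrow> smooth_on S (iter_deriv I f)"
  by (induction I) (auto intro: smooth_on_frechet_derivative)

lemma iter_deriv_cong:
  assumes "open S" "x \<in> S" "smooth_on S f" "\<And>y. y \<in> S \<Longrightarrow> f y = g y"
  shows "iter_deriv I f x = iter_deriv I g x"
  using assms(2)
proof (induction I arbitrary: x)
  case Nil
  then show ?case using assms by simp
next
  case (Cons b I)
  have "frechet_derivative (iter_deriv I f) (at x) = frechet_derivative (iter_deriv I g) (at x)"
    by (rule frechet_derivative_cong[OF assms(1) Cons.prems])
      (use Cons.IH smooth_on_iter_deriv[OF assms(3)] in auto)
  then show ?case by simp
qed

lemma iter_deriv_add:
  assumes "open S" "x \<in> S" "smooth_on S f" "smooth_on S g"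
  shows "iter_deriv I (\<lambda>y. f y + g y) x = iter_deriv I f x + iter_deriv I g x"
  using assms(2)
proof (induction I arbitrary: x)
  case Nil
  then show ?case by simp
next
  case (Cons b I)
  note s = smooth_on_iter_deriv[OF assms(3), of I] smooth_on_iter_deriv[OF assms(4), of I]
  have "frechet_derivative (iter_deriv I (\<lambda>y. f y + g y)) (at x) =
      frechet_derivative (\<lambda>y. iter_deriv I f y + iter_deriv I g y) (at x)"
    by (rule frechet_derivative_cong[OF assms(1) Cons.prems, symmetric])
      (use Cons.IH smooth_on_add[OF assms(1) s] in auto)
  also have "\<dots> = (\<lambda>v. frechet_derivative (iter_deriv I f) (at x) v
      + frechet_derivative (iter_deriv I g) (at x) v)"
    using s Cons.prems
    by (intro frechet_derivative_at[symmetric] has_derivative_add smooth_on_has_derivative)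
  finally show ?case by simp
qed

text \<open>By this a differential operator acting in the second variable becomes an expression on
  the product, which can then be differentiated in the first variable as well.\<close>

lemma iter_deriv_Pair_zero:
  fixes W :: "'a::euclidean_space \<times> 'b::euclidean_space \<Rightarrow> 'c::real_normed_vector"
  assumes "open P" "open Q" "smooth_on (P \<times> Q) W" "x \<in> P" "y \<in> Q"
  shows "iter_deriv I (\<lambda>y. W (x, y)) y = iter_deriv (map (Pair 0) I) W (x, y)"
  using assms(5)
proof (induction I arbitrary: y)
  case Nil
  then show ?case by simp
next
  case (Cons b I)
  let ?J = "map (Pair 0) I"
  have sm: "smooth_on (P \<times> Q) (iter_deriv ?J W)"
    using smooth_on_iter_deriv[OF assms(3)] .
  have sp: "smooth_on Q (\<lambda>y. (x, y))"
    by (intro smooth_on_Pair assms smooth_on_const smooth_on_bounded_linear bounded_linear_ident)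
  have sx: "smooth_on Q (\<lambda>y. iter_deriv ?J W (x, y))"
    by (rule smooth_on_compose[OF assms(2) sp sm]) (use assms(4) in auto)
  have "frechet_derivative (iter_deriv I (\<lambda>y. W (x, y))) (at y) =
     frechet_derivative (\<lambda>y. iter_deriv ?J W (x, y)) (at y)"
    by (rule frechet_derivative_cong[OF assms(2) Cons.prems _ sx, symmetric])
      (use Cons.IH in auto)
  moreover have "((\<lambda>y. iter_deriv ?J W (x, y)) has_derivative
      (\<lambda>v. frechet_derivative (iter_deriv ?J W) (at (x, y)) (0, v))) (at y)"
  proof -
    have "((\<lambda>y. (x, y)) has_derivative (\<lambda>v. (0, v))) (at y)"
      by (auto intro!: derivative_eq_intros)
    from diff_chain_at[OF this smooth_on_has_derivative[OF sm]] show ?thesis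
      using assms(4) Cons.prems by (simp add: o_def)
  qed
  ultimately have "frechet_derivative (iter_deriv I (\<lambda>y. W (x, y))) (at y) =
      (\<lambda>v. frechet_derivative (iter_deriv ?J W) (at (x, y)) (0, v))"
    using frechet_derivative_at by metis
  then show ?case by simp
qed

section \<open>Symmetry of second derivatives\<close>

lemma second_difference:
  fixes f :: "'a::real_normed_vector \<Rightarrow> real"
  assumes "smooth_on S f" "0 < h"
    and "\<And>s t. 0 \<le> s \<Longrightarrow> s \<le> h \<Longrightarrow> 0 \<le> t \<Longrightarrow> t \<le> h \<Longrightarrow> x + s *\<^sub>R a + t *\<^sub>R b \<in> S"
  shows "\<exists>s t. 0 \<le> s \<and> s \<le> h \<and> 0 \<le> t \<and> t \<le> h \<and>
    f (x + h *\<^sub>R a + h *\<^sub>R b) - f (x + h *\<^sub>R a) - f (x + h *\<^sub>R b) + f x =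
    h * h * frechet_derivative (\<lambda>y. frechet_derivative f (at y) a) (at (x + s *\<^sub>R a + t *\<^sub>R b)) b"
proof -
  define Fa where "Fa = (\<lambda>y. frechet_derivative f (at y) a)"
  have der: "((\<lambda>s. k (p + s *\<^sub>R c)) has_real_derivative frechet_derivative k (at (p + s *\<^sub>R c)) c) (at s)"
    if "smooth_on S k" "p + s *\<^sub>R c \<in> S" for k :: "'a \<Rightarrow> real" and p c s
  proof -
    have "((\<lambda>s. p + s *\<^sub>R c) has_derivative (\<lambda>r. r *\<^sub>R c)) (at s)"
      by (auto intro!: derivative_eq_intros)
    from diff_chain_at[OF this smooth_on_has_derivative[OF that]]
    have "((\<lambda>s. k (p + s *\<^sub>R c)) has_derivative
        (\<lambda>r. frechet_derivative k (at (p + s *\<^sub>R c)) (r *\<^sub>R c))) (at s)"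
      by (simp add: o_def)
    moreover have "(\<lambda>r. frechet_derivative k (at (p + s *\<^sub>R c)) (r *\<^sub>R c)) =
        (*) (frechet_derivative k (at (p + s *\<^sub>R c)) c)"
      using has_derivative_linear[OF smooth_on_has_derivative[OF that]]
      by (auto simp: linear_cmul mult.commute)
    ultimately show ?thesis
      by (simp add: has_field_derivative_def)
  qed
  \<comment> \<open>Mean value theorem along \<open>a\<close>, applied to the increment of
    \<open>f\<close> in direction \<open>b\<close>; this step restricts the lemma to real
    values.\<close>
  have "\<exists>s. 0 < s \<and> s < h \<and>
      (f (x + h *\<^sub>R b + h *\<^sub>R a) - f (x + h *\<^sub>R a)) - (f (x + h *\<^sub>R b + 0 *\<^sub>R a) - f (x + 0 *\<^sub>R a)) =
      (h - 0) * (Fa (x + h *\<^sub>R b + s *\<^sub>R a) - Fa (x + s *\<^sub>R a))"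
  proof (rule MVT2[where f = "\<lambda>s. f (x + h *\<^sub>R b + s *\<^sub>R a) - f (x + s *\<^sub>R a)"])
    fix s assume "0 \<le> s" "s \<le> h"
    then show "((\<lambda>s. f (x + h *\<^sub>R b + s *\<^sub>R a) - f (x + s *\<^sub>R a)) has_real_derivative
        Fa (x + h *\<^sub>R b + s *\<^sub>R a) - Fa (x + s *\<^sub>R a)) (at s)"
      unfolding Fa_def using assms(2) assms(3)[of s h] assms(3)[of s 0]
      by (intro DERIV_diff der assms(1)) (auto simp: algebra_simps)
  qed (rule assms(2))
  then obtain s where s: "0 < s" "s < h"
    "f (x + h *\<^sub>R a + h *\<^sub>R b) - f (x + h *\<^sub>R a) - f (x + h *\<^sub>R b) + f x =
      h * (Fa (x + s *\<^sub>R a + h *\<^sub>R b) - Fa (x + s *\<^sub>R a))"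
    by (auto simp: algebra_simps)
  \<comment> \<open>Mean value theorem along \<open>b\<close>, applied to the derivative along
    \<open>a\<close>.\<close>
  have "\<exists>t. 0 < t \<and> t < h \<and> Fa (x + s *\<^sub>R a + h *\<^sub>R b) - Fa (x + s *\<^sub>R a + 0 *\<^sub>R b) =
      (h - 0) * frechet_derivative Fa (at (x + s *\<^sub>R a + t *\<^sub>R b)) b"
  proof (rule MVT2[where f = "\<lambda>t. Fa (x + s *\<^sub>R a + t *\<^sub>R b)"])
    fix t assume "0 \<le> t" "t \<le> h"
    then show "((\<lambda>t. Fa (x + s *\<^sub>R a + t *\<^sub>R b)) has_real_derivative
        frechet_derivative Fa (at (x + s *\<^sub>R a + t *\<^sub>R b)) b) (at t)"
      unfolding Fa_def using s assms(3)[of s t]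
      by (intro der smooth_on_frechet_derivative assms(1)) auto
  qed (rule assms(2))
  then obtain t where "0 < t" "t < h" "Fa (x + s *\<^sub>R a + h *\<^sub>R b) - Fa (x + s *\<^sub>R a) =
      h * frechet_derivative Fa (at (x + s *\<^sub>R a + t *\<^sub>R b)) b"
    by auto
  then show ?thesis
    using s unfolding Fa_def by (intro exI[of _ s] exI[of _ t]) auto
qed

text \<open>The second difference over a small parallelogram at \<open>x\<close> is symmetric in
  \<open>a\<close> and \<open>b\<close>. Hence one mixed derivative at some point near
  \<open>x\<close> equals the other at some other point near \<open>x\<close>, which continuity
  forbids if they differ at \<open>x\<close>.\<close>

lemma frechet_derivative_commute_real:
  fixes f :: "'a::real_normed_vector \<Rightarrow> real"
  assumes "open S" "x \<in> S" "smooth_on S f"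
  shows "frechet_derivative (\<lambda>y. frechet_derivative f (at y) a) (at x) b =
         frechet_derivative (\<lambda>y. frechet_derivative f (at y) b) (at x) a" (is "?A x = ?B x")
proof (rule ccontr)
  assume ne: "?A x \<noteq> ?B x"
  \<comment> \<open>Half the gap: a number within \<open>e\<close> of one value cannot be within
    \<open>e\<close> of the other.\<close>
  define e where "e = \<bar>?A x - ?B x\<bar> / 2"
  have "e > 0" using ne by (simp add: e_def)
  have "continuous_on S ?A" "continuous_on S ?B"
    by (intro smooth_on_continuous_on smooth_on_frechet_derivative assms)+
  then have "isCont ?A x" "isCont ?B x"
    using assms(1,2) continuous_on_eq_continuous_at by blast+
  then obtain d1 d2 where d12: "d1 > 0" "d2 > 0"
    "\<And>y. dist y x < d1 \<Longrightarrow> dist (?A y) (?A x) < e" "\<And>y. dist y x < d2 \<Longrightarrow> dist (?B y) (?B x) < e"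
    using \<open>e > 0\<close> unfolding continuous_at_eps_delta by metis
  obtain d3 where d3: "d3 > 0" "ball x d3 \<subseteq> S"
    using assms(1,2) openE by blast
  define d where "d = min d1 (min d2 d3)"
  \<comment> \<open>The summand 1 keeps \<open>M\<close> positive when \<open>a\<close> and
    \<open>b\<close> vanish; with this \<open>h\<close> the parallelogram stays within d/2 of
    \<open>x\<close>.\<close>
  define M where "M = norm a + norm b + 1"
  define h where "h = d / (2 * M)"
  have "M > 0" unfolding M_def by (smt (verit) norm_ge_zero)
  have "d > 0" using d12 d3 by (simp add: d_def)
  then have "h > 0" using \<open>M > 0\<close> by (simp add: h_def)
  have hd: "h * (norm a + norm b) < d"
  proof -
    have "h * (norm a + norm b) \<le> h * M"
      using \<open>h > 0\<close> by (simp add: M_def)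
    also have "\<dots> = d / 2" using \<open>M > 0\<close> by (simp add: h_def)
    finally show ?thesis using \<open>d > 0\<close> by simp
  qed
  have near: "dist (x + s *\<^sub>R a + t *\<^sub>R b) x < d" if "0 \<le> s" "s \<le> h" "0 \<le> t" "t \<le> h" for s t
  proof -
    have "dist (x + s *\<^sub>R a + t *\<^sub>R b) x \<le> norm (s *\<^sub>R a) + norm (t *\<^sub>R b)"
      using norm_triangle_ineq[of "s *\<^sub>R a" "t *\<^sub>R b"] by (simp add: dist_norm add.assoc)
    also have "\<dots> \<le> h * norm a + h * norm b"
      using that by (auto intro!: add_mono mult_right_mono)
    also have "\<dots> < d" using hd by (simp add: algebra_simps)
    finally show ?thesis .
  qed
  have inS: "x + s *\<^sub>R a + t *\<^sub>R b \<in> S" if "0 \<le> s" "s \<le> h" "0 \<le> t" "t \<le> h" for s t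
    using near[OF that] d3(2) by (auto simp: d_def dist_commute subset_iff)
  obtain s t where 1: "0 \<le> s" "s \<le> h" "0 \<le> t" "t \<le> h"
    "f (x + h *\<^sub>R a + h *\<^sub>R b) - f (x + h *\<^sub>R a) - f (x + h *\<^sub>R b) + f x
      = h * h * ?A (x + s *\<^sub>R a + t *\<^sub>R b)"
    using second_difference[OF assms(3) \<open>h > 0\<close> inS] by blast
  \<comment> \<open>The same parallelogram, with the two directions exchanged.\<close>
  have "x + s *\<^sub>R b + t *\<^sub>R a \<in> S" if "0 \<le> s" "s \<le> h" "0 \<le> t" "t \<le> h" for s t
    using inS[of t s] that by (simp add: algebra_simps)
  then obtain s' t' where 2: "0 \<le> s'" "s' \<le> h" "0 \<le> t'" "t' \<le> h"
    "f (x + h *\<^sub>R b + h *\<^sub>R a) - f (x + h *\<^sub>R b) - f (x + h *\<^sub>R a) + f x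
      = h * h * ?B (x + s' *\<^sub>R b + t' *\<^sub>R a)"
    using second_difference[OF assms(3) \<open>h > 0\<close>, of x b a] by blast
  have "h * h * ?A (x + s *\<^sub>R a + t *\<^sub>R b) = h * h * ?B (x + s' *\<^sub>R b + t' *\<^sub>R a)"
    using 1(5) 2(5) by (simp add: algebra_simps)
  then have "?A (x + s *\<^sub>R a + t *\<^sub>R b) = ?B (x + s' *\<^sub>R b + t' *\<^sub>R a)"
    using \<open>h > 0\<close> by simp
  moreover have "dist (?A (x + s *\<^sub>R a + t *\<^sub>R b)) (?A x) < e"
    using near[OF 1(1-4)] by (intro d12) (simp add: d_def)
  moreover have "dist (?B (x + s' *\<^sub>R b + t' *\<^sub>R a)) (?B x) < e"
    using near[OF 2(3,4,1,2)] by (intro d12) (simp add: d_def algebra_simps)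
  ultimately show False
    unfolding e_def dist_real_def by (simp add: field_simps) argo
qed

lemma frechet_derivative_bounded_linear_comp:
  assumes "bounded_linear h" "smooth_on S f" "x \<in> S"
  shows "frechet_derivative (\<lambda>y. h (f y)) (at x) v = h (frechet_derivative f (at x) v)"
  using frechet_derivative_at[OF bounded_linear.has_derivative[OF assms(1)
      smooth_on_has_derivative[OF assms(2,3)]]] by metis

text \<open>Inner products with fixed vectors are bounded linear and pass through derivatives, which
  reduces the claim to real values. Complex values are covered as a Euclidean space.\<close>

lemma frechet_derivative_commute:
  fixes f :: "'a::real_normed_vector \<Rightarrow> 'b::euclidean_space"
  assumes "open S" "x \<in> S" "smooth_on S f"
  shows "frechet_derivative (\<lambda>y. frechet_derivative f (at y) a) (at x) b =
         frechet_derivative (\<lambda>y. frechet_derivative f (at y) b) (at x) a"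
proof (rule euclidean_eqI)
  fix c :: 'b
  note bl = bounded_linear_inner_left[of c]
  have *: "frechet_derivative (\<lambda>y. frechet_derivative f (at y) a) (at x) b \<bullet> c =
      frechet_derivative (\<lambda>y. frechet_derivative (\<lambda>z. f z \<bullet> c) (at y) a) (at x) b" for a b
  proof -
    have "frechet_derivative (\<lambda>y. frechet_derivative f (at y) a) (at x) b \<bullet> c =
        frechet_derivative (\<lambda>y. frechet_derivative f (at y) a \<bullet> c) (at x) b"
      by (rule frechet_derivative_bounded_linear_comp[OF bl _ assms(2), symmetric])
        (intro smooth_on_frechet_derivative assms)
    also have "\<dots> = frechet_derivative (\<lambda>y. frechet_derivative (\<lambda>z. f z \<bullet> c) (at y) a) (at x) b"
      using frechet_derivative_cong[OF assms(1,2), of "\<lambda>y. frechet_derivative f (at y) a \<bullet> c"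
          "\<lambda>y. frechet_derivative (\<lambda>z. f z \<bullet> c) (at y) a"]
        frechet_derivative_bounded_linear_comp[OF bl assms(3)]
        smooth_on_bounded_linear_comp[OF bl assms(1) smooth_on_frechet_derivative[OF assms(3)]]
      by metis
    finally show ?thesis .
  qed
  show "frechet_derivative (\<lambda>y. frechet_derivative f (at y) a) (at x) b \<bullet> c =
      frechet_derivative (\<lambda>y. frechet_derivative f (at y) b) (at x) a \<bullet> c"
    unfolding * by (rule frechet_derivative_commute_real[OF assms(1,2)])
      (rule smooth_on_bounded_linear_comp[OF bl assms(1,3)])
qed

text \<open>The direction \<open>v\<close> passes one letter of the word at a time, each time by
  symmetry of second derivatives. On a product this moves a derivative along the group past those
  along the manifold.\<close>

lemma iter_deriv_frechet_derivative:
  fixes f :: "'a::real_normed_vector \<Rightarrow> 'b::euclidean_space"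
  assumes "open S" "x \<in> S" "smooth_on S f"
  shows "iter_deriv I (\<lambda>y. frechet_derivative f (at y) v) x = frechet_derivative (iter_deriv I f) (at x) v"
  using assms(2)
proof (induction I arbitrary: x)
  case Nil
  then show ?case by simp
next
  case (Cons b I)
  have s: "smooth_on S (iter_deriv I f)" by (rule smooth_on_iter_deriv[OF assms(3)])
  have "frechet_derivative (iter_deriv I (\<lambda>y. frechet_derivative f (at y) v)) (at x) =
      frechet_derivative (\<lambda>y. frechet_derivative (iter_deriv I f) (at y) v) (at x)"
    by (rule frechet_derivative_cong[OF assms(1) Cons.prems])
      (use Cons.IH assms(3) in \<open>auto intro: smooth_on_frechet_derivative smooth_on_iter_deriv\<close>)
  then show ?case
    using frechet_derivative_commute[OF assms(1) Cons.prems s] by simp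
qed

section \<open>Charts and smooth maps\<close>

context
  fixes A :: "('m::{t2_space, second_countable_topology}, 'e::euclidean_space) atlas" and U \<phi>
  assumes atlas: "smooth_atlas A" and chart: "(U, \<phi>) \<in> A"
begin

lemma chart_homeomorphism: "homeomorphism U (\<phi> ` U) \<phi> (inv_into U \<phi>)"
  and open_chart_domain: "open U"
  and open_chart_image: "open (\<phi> ` U)"
  using atlas chart unfolding smooth_atlas_def by blast+

lemma chart_continuous_on: "continuous_on U \<phi>"
  and chart_inv_continuous_on: "continuous_on (\<phi> ` U) (inv_into U \<phi>)"
  and chart_inv [simp]: "p \<in> U \<Longrightarrow> inv_into U \<phi> (\<phi> p) = p"
  using chart_homeomorphism unfolding homeomorphism_def by auto

lemma chart_inj_on: "inj_on \<phi> U"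
  by (metis chart_inv inj_on_def)

lemma open_chart_image_Int:
  assumes "open W"
  shows "open (\<phi> ` (U \<inter> W))"
proof -
  have "\<phi> ` (U \<inter> W) = \<phi> ` U \<inter> inv_into U \<phi> -` W"
    by auto
  then show ?thesis
    using continuous_open_preimage[OF chart_inv_continuous_on open_chart_image assms] by simp
qed

end

lemma obtain_chart:
  assumes "smooth_atlas A"
  obtains U \<phi> where "(U, \<phi>) \<in> A" "p \<in> U"
proof -
  have "p \<in> (\<Union>(U, \<phi>)\<in>A. U)" using assms unfolding smooth_atlas_def by simp
  then show ?thesis using that by auto
qed

lemma smooth_mapD:
  assumes "smooth_map A B F" "(U, \<phi>) \<in> A" "(V, \<psi>) \<in> B"
  shows "smooth_on (\<phi> ` (U \<inter> F -` V)) (\<lambda>x. \<psi> (F (inv_into U \<phi> x)))"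
  using assms unfolding smooth_map_def by (fastforce simp: o_def)

lemma smooth_map_continuous: "smooth_map A B F \<Longrightarrow> continuous_on UNIV F"
  unfolding smooth_map_def by simp

lemma smooth_mapI:
  assumes "continuous_on UNIV F"
    "\<And>U \<phi> V \<psi>. (U, \<phi>) \<in> A \<Longrightarrow> (V, \<psi>) \<in> B \<Longrightarrow>
      smooth_on (\<phi> ` (U \<inter> F -` V)) (\<lambda>x. \<psi> (F (inv_into U \<phi> x)))"
  shows "smooth_map A B F"
  using assms unfolding smooth_map_def by (auto simp: o_def)

text \<open>No single chart of the middle manifold need contain the image, so smoothness is checked
  near each point, on the part of the source chart that \<open>F\<close> sends into one chart
  \<open>V\<close> and \<open>K\<close> then into \<open>W\<close>.\<close>

lemma smooth_map_compose:
  assumes A: "smooth_atlas A" and B: "smooth_atlas B" and C: "smooth_atlas C"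
    and F: "smooth_map A B F" and K: "smooth_map B C K"
  shows "smooth_map A C (\<lambda>x. K (F x))"
proof (rule smooth_mapI)
  show "continuous_on UNIV (\<lambda>x. K (F x))"
    using continuous_on_compose2[OF smooth_map_continuous[OF K] smooth_map_continuous[OF F]] by simp
  fix U \<phi> W \<theta> assume U: "(U, \<phi>) \<in> A" and W: "(W, \<theta>) \<in> C"
  show "smooth_on (\<phi> ` (U \<inter> (\<lambda>x. K (F x)) -` W)) (\<lambda>x. \<theta> (K (F (inv_into U \<phi> x))))"
  proof (rule smooth_on_local)
    fix x assume "x \<in> \<phi> ` (U \<inter> (\<lambda>x. K (F x)) -` W)"
    then obtain p where p: "p \<in> U" "K (F p) \<in> W" "x = \<phi> p" by auto
    obtain V \<psi> where V: "(V, \<psi>) \<in> B" "F p \<in> V" using obtain_chart[OF B] .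
    let ?O = "V \<inter> K -` W"
    have "open ?O"
      using open_chart_domain[OF B V(1)] open_chart_domain[OF C W] smooth_map_continuous[OF K]
      by (simp add: open_vimage open_Int)
    then have "open (F -` ?O)"
      by (rule open_vimage[OF _ smooth_map_continuous[OF F]])
    then have o: "open (\<phi> ` (U \<inter> F -` ?O))" by (rule open_chart_image_Int[OF A U])
    have s: "smooth_on (\<phi> ` (U \<inter> F -` ?O)) (\<lambda>x. \<psi> (F (inv_into U \<phi> x)))"
      by (rule smooth_on_subset[OF smooth_mapD[OF F U V(1)]]) auto
    have "smooth_on (\<phi> ` (U \<inter> F -` ?O)) (\<lambda>x. \<theta> (K (inv_into V \<psi> (\<psi> (F (inv_into U \<phi> x))))))"
      by (rule smooth_on_compose[OF o s smooth_mapD[OF K V(1) W]]) (auto simp: chart_inv[OF A U])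
    then have "smooth_on (\<phi> ` (U \<inter> F -` ?O)) (\<lambda>x. \<theta> (K (F (inv_into U \<phi> x))))"
      by (rule smooth_on_cong[OF o]) (auto simp: chart_inv[OF A U] chart_inv[OF B V(1)])
    then show "\<exists>T. open T \<and> x \<in> T \<and> smooth_on T (\<lambda>x. \<theta> (K (F (inv_into U \<phi> x))))"
      using o p V(2) by (intro exI[of _ "\<phi> ` (U \<inter> F -` ?O)"]) auto
  qed
qed

lemma smooth_map_const: "smooth_map A B (\<lambda>_. c)"
  by (rule smooth_mapI) (auto simp: smooth_on_const)

text \<open>This is precisely the compatibility of charts; applied to two charts of the atlas it
  yields the smoothness of their transition map.\<close>

lemma smooth_map_ident: "smooth_atlas A \<Longrightarrow> smooth_map A A (\<lambda>x. x)"
proof (rule smooth_mapI)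
  fix U \<phi> V \<psi> assume "smooth_atlas A" "(U, \<phi>) \<in> A" "(V, \<psi>) \<in> A"
  then show "smooth_on (\<phi> ` (U \<inter> (\<lambda>x. x) -` V)) (\<lambda>x. \<psi> (inv_into U \<phi> x))"
    unfolding smooth_atlas_def by (fastforce simp: o_def)
qed simp

section \<open>Product manifolds\<close>

lemma prod_atlas_iff:
  "(X, \<theta>) \<in> prod_atlas A B \<longleftrightarrow>
    (\<exists>U \<phi> V \<psi>. (U, \<phi>) \<in> A \<and> (V, \<psi>) \<in> B \<and> X = U \<times> V \<and> \<theta> = map_prod \<phi> \<psi>)"
  unfolding prod_atlas_def by (force simp: image_iff)

lemma smooth_map_Pair:
  assumes A: "smooth_atlas A" and B: "smooth_atlas B" and C: "smooth_atlas C"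
    and F: "smooth_map A B F" and K: "smooth_map A C K"
  shows "smooth_map A (prod_atlas B C) (\<lambda>x. (F x, K x))"
proof (rule smooth_mapI)
  show "continuous_on UNIV (\<lambda>x. (F x, K x))"
    by (intro continuous_on_Pair smooth_map_continuous[OF F] smooth_map_continuous[OF K])
  fix U \<phi> X \<theta> assume U: "(U, \<phi>) \<in> A" and "(X, \<theta>) \<in> prod_atlas B C"
  then obtain V \<psi> W \<eta> where V: "(V, \<psi>) \<in> B" and W: "(W, \<eta>) \<in> C"
    and X: "X = V \<times> W" "\<theta> = map_prod \<psi> \<eta>"
    unfolding prod_atlas_iff by blast
  have "open ((\<lambda>x. (F x, K x)) -` X)"
    unfolding X using open_chart_domain[OF B V] open_chart_domain[OF C W]
      continuous_on_Pair[OF smooth_map_continuous[OF F] smooth_map_continuous[OF K]]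
    by (simp add: open_vimage open_Times)
  then have "open (\<phi> ` (U \<inter> (\<lambda>x. (F x, K x)) -` X))" by (rule open_chart_image_Int[OF A U])
  then show "smooth_on (\<phi> ` (U \<inter> (\<lambda>x. (F x, K x)) -` X)) (\<lambda>x. \<theta> (F (inv_into U \<phi> x), K (inv_into U \<phi> x)))"
    unfolding X map_prod_simp
    by (rule smooth_on_Pair)
      (auto intro: smooth_on_subset[OF smooth_mapD[OF F U V]] smooth_on_subset[OF smooth_mapD[OF K U W]])
qed

text \<open>\<open>inv_into\<close> picks some preimage; injectivity of both charts makes it unique,
  so that it splits into components.\<close>

lemma inv_into_map_prod:
  assumes "inj_on \<phi> U" "inj_on \<psi> V" "x \<in> \<phi> ` U" "y \<in> \<psi> ` V"
  shows "inv_into (U \<times> V) (map_prod \<phi> \<psi>) (x, y) = (inv_into U \<phi> x, inv_into V \<psi> y)"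
  using assms by (intro inv_into_f_eq map_prod_inj_on) (auto simp: f_inv_into_f)

lemma smooth_atlas_prod:
  fixes A :: "('m::{t2_space, second_countable_topology}, 'e::euclidean_space) atlas"
    and B :: "('n::{t2_space, second_countable_topology}, 'd::euclidean_space) atlas"
  assumes A: "smooth_atlas A" and B: "smooth_atlas B"
  shows "smooth_atlas (prod_atlas A B)"
  unfolding smooth_atlas_def
proof (intro conjI)
  show "(\<Union>(U, \<phi>)\<in>prod_atlas A B. U) = UNIV"
  proof (rule sym, rule UNIV_eq_I)
    fix z :: "'m \<times> 'n"
    obtain U \<phi> where "(U, \<phi>) \<in> A" "fst z \<in> U" using obtain_chart[OF A] .
    moreover obtain V \<psi> where "(V, \<psi>) \<in> B" "snd z \<in> V" using obtain_chart[OF B] .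
    ultimately have "(U \<times> V, map_prod \<phi> \<psi>) \<in> prod_atlas A B" "z \<in> U \<times> V"
      by (auto simp: prod_atlas_iff mem_Times_iff)
    then show "z \<in> (\<Union>(U, \<phi>)\<in>prod_atlas A B. U)" by blast
  qed
  show "\<forall>(X, \<theta>)\<in>prod_atlas A B. open X \<and> open (\<theta> ` X) \<and> homeomorphism X (\<theta> ` X) \<theta> (inv_into X \<theta>)"
  proof clarify
    fix X \<theta> assume "(X, \<theta>) \<in> prod_atlas A B"
    then obtain U \<phi> V \<psi> where U: "(U, \<phi>) \<in> A" and V: "(V, \<psi>) \<in> B"
      and X: "X = U \<times> V" "\<theta> = map_prod \<phi> \<psi>"
      unfolding prod_atlas_iff by blast
    have im: "\<theta> ` X = \<phi> ` U \<times> \<psi> ` V" by (auto simp: X image_iff map_prod_def)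
    have inj: "inj_on \<theta> X"
      unfolding X by (intro map_prod_inj_on chart_inj_on[OF A U] chart_inj_on[OF B V])
    have "continuous_on X \<theta>"
      unfolding X map_prod_def case_prod_beta
      by (intro continuous_on_Pair continuous_on_compose2[OF chart_continuous_on[OF A U]]
          continuous_on_compose2[OF chart_continuous_on[OF B V]] continuous_on_fst continuous_on_snd
          continuous_on_id) auto
    moreover have "continuous_on (\<theta> ` X) (inv_into X \<theta>)"
    proof -
      have "continuous_on (\<phi> ` U \<times> \<psi> ` V) (\<lambda>z. (inv_into U \<phi> (fst z), inv_into V \<psi> (snd z)))"
        by (intro continuous_on_Pair continuous_on_compose2[OF chart_inv_continuous_on[OF A U]]
            continuous_on_compose2[OF chart_inv_continuous_on[OF B V]] continuous_on_fst continuous_on_snd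
            continuous_on_id) auto
      then show ?thesis
        unfolding im using inv_into_map_prod[OF chart_inj_on[OF A U] chart_inj_on[OF B V]] X
        by (subst continuous_on_cong[OF refl]) auto
    qed
    ultimately have "homeomorphism X (\<theta> ` X) \<theta> (inv_into X \<theta>)"
      using inj by (intro homeomorphismI) (auto simp: f_inv_into_f inv_into_into)
    moreover have "open X" "open (\<theta> ` X)"
      unfolding im unfolding X
      using open_chart_domain[OF A U] open_chart_domain[OF B V]
        open_chart_image[OF A U] open_chart_image[OF B V]
      by (simp_all add: open_Times)
    ultimately show "open X \<and> open (\<theta> ` X) \<and> homeomorphism X (\<theta> ` X) \<theta> (inv_into X \<theta>)" by blast
  qed
  show "\<forall>(X, \<theta>)\<in>prod_atlas A B. \<forall>(Y, \<eta>)\<in>prod_atlas A B.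
      smooth_on (\<theta> ` (X \<inter> Y)) (\<eta> \<circ> inv_into X \<theta>)"
  proof clarify
    fix X \<theta> Y \<eta> assume "(X, \<theta>) \<in> prod_atlas A B" "(Y, \<eta>) \<in> prod_atlas A B"
    then obtain U \<phi> V \<psi> U' \<phi>' V' \<psi>' where U: "(U, \<phi>) \<in> A" and V: "(V, \<psi>) \<in> B"
      and X: "X = U \<times> V" "\<theta> = map_prod \<phi> \<psi>"
      and U': "(U', \<phi>') \<in> A" and V': "(V', \<psi>') \<in> B"
      and Y: "Y = U' \<times> V'" "\<eta> = map_prod \<phi>' \<psi>'"
      unfolding prod_atlas_iff by blast
    let ?P = "\<phi> ` (U \<inter> U')" and ?Q = "\<psi> ` (V \<inter> V')"
    have op: "open ?P" "open ?Q"
      by (intro open_chart_image_Int[OF A U] open_chart_domain[OF A U']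
          open_chart_image_Int[OF B V] open_chart_domain[OF B V'])+
    have im: "\<theta> ` (X \<inter> Y) = ?P \<times> ?Q" by (auto simp: X Y image_iff map_prod_def)
    have opPQ: "open (?P \<times> ?Q)" using op by (simp add: open_Times)
    have s1: "smooth_on ?P (\<lambda>x. \<phi>' (inv_into U \<phi> x))" and s2: "smooth_on ?Q (\<lambda>x. \<psi>' (inv_into V \<psi> x))"
      using smooth_mapD[OF smooth_map_ident[OF A] U U'] smooth_mapD[OF smooth_map_ident[OF B] V V']
      by (simp_all add: vimage_def)
    have "smooth_on (?P \<times> ?Q) (\<lambda>z. (\<phi>' (inv_into U \<phi> (fst z)), \<psi>' (inv_into V \<psi> (snd z))))"
      by (intro smooth_on_Pair opPQ smooth_on_compose[OF opPQ _ s1] smooth_on_compose[OF opPQ _ s2]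
          smooth_on_bounded_linear bounded_linear_fst bounded_linear_snd) auto
    then show "smooth_on (\<theta> ` (X \<inter> Y)) (\<eta> \<circ> inv_into X \<theta>)"
      unfolding im by (rule smooth_on_cong[OF opPQ])
        (auto simp: X Y inv_into_map_prod[OF chart_inj_on[OF A U] chart_inj_on[OF B V]])
  qed
qed

lemma
  assumes A: "smooth_atlas A" and B: "smooth_atlas B"
  shows smooth_map_fst: "smooth_map (prod_atlas A B) A fst"
    and smooth_map_snd: "smooth_map (prod_atlas A B) B snd"
proof -
  note AB = smooth_atlas_prod[OF A B]
  show "smooth_map (prod_atlas A B) A fst"
  proof (rule smooth_mapI)
    show "continuous_on UNIV fst" by (intro continuous_on_fst continuous_on_id)
    fix X \<theta> U' \<phi>' assume X0: "(X, \<theta>) \<in> prod_atlas A B" and U': "(U', \<phi>') \<in> A"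
    then obtain U \<phi> V \<psi> where U: "(U, \<phi>) \<in> A" and V: "(V, \<psi>) \<in> B"
      and X: "X = U \<times> V" "\<theta> = map_prod \<phi> \<psi>"
      unfolding prod_atlas_iff by blast
    have o: "open (\<theta> ` (X \<inter> fst -` U'))"
      by (intro open_chart_image_Int[OF AB X0] open_vimage_fst open_chart_domain[OF A U'])
    have s: "smooth_on (\<phi> ` (U \<inter> U')) (\<lambda>x. \<phi>' (inv_into U \<phi> x))"
      using smooth_mapD[OF smooth_map_ident[OF A] U U'] by (simp add: vimage_def)
    have "smooth_on (\<theta> ` (X \<inter> fst -` U')) (\<lambda>z. \<phi>' (inv_into U \<phi> (fst z)))"
      by (rule smooth_on_compose[OF o _ s]) (auto intro: smooth_on_bounded_linear bounded_linear_fst simp: X)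
    then show "smooth_on (\<theta> ` (X \<inter> fst -` U')) (\<lambda>x. \<phi>' (fst (inv_into X \<theta> x)))"
      by (rule smooth_on_cong[OF o])
        (auto simp: X inv_into_map_prod[OF chart_inj_on[OF A U] chart_inj_on[OF B V]])
  qed
  show "smooth_map (prod_atlas A B) B snd"
  proof (rule smooth_mapI)
    show "continuous_on UNIV snd" by (intro continuous_on_snd continuous_on_id)
    fix X \<theta> U' \<phi>' assume X0: "(X, \<theta>) \<in> prod_atlas A B" and U': "(U', \<phi>') \<in> B"
    then obtain U \<phi> V \<psi> where U: "(U, \<phi>) \<in> A" and V: "(V, \<psi>) \<in> B"
      and X: "X = U \<times> V" "\<theta> = map_prod \<phi> \<psi>"
      unfolding prod_atlas_iff by blast
    have o: "open (\<theta> ` (X \<inter> snd -` U'))"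
      by (intro open_chart_image_Int[OF AB X0] open_vimage_snd open_chart_domain[OF B U'])
    have s: "smooth_on (\<psi> ` (V \<inter> U')) (\<lambda>x. \<phi>' (inv_into V \<psi> x))"
      using smooth_mapD[OF smooth_map_ident[OF B] V U'] by (simp add: vimage_def)
    have "smooth_on (\<theta> ` (X \<inter> snd -` U')) (\<lambda>z. \<phi>' (inv_into V \<psi> (snd z)))"
      by (rule smooth_on_compose[OF o _ s]) (auto intro: smooth_on_bounded_linear bounded_linear_snd simp: X)
    then show "smooth_on (\<theta> ` (X \<inter> snd -` U')) (\<lambda>x. \<phi>' (snd (inv_into X \<theta> x)))"
      by (rule smooth_on_cong[OF o])
        (auto simp: X inv_into_map_prod[OF chart_inj_on[OF A U] chart_inj_on[OF B V]])
  qed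
qed

section \<open>Smooth functions\<close>

text \<open>Regarding functions as maps into this atlas makes the lemmas on smooth maps available.\<close>

definition std_atlas :: "('e::euclidean_space, 'e) atlas" where
  "std_atlas = {(UNIV, \<lambda>x. x)}"

lemma inv_into_UNIV_ident [simp]: "inv_into UNIV (\<lambda>x. x) = (\<lambda>x. x)"
  using inv_id by (simp add: id_def)

lemma smooth_atlas_std: "smooth_atlas std_atlas"
  unfolding smooth_atlas_def std_atlas_def
  by (auto simp: homeomorphism_def o_def intro: smooth_on_bounded_linear bounded_linear_ident)

lemma smooth_funD:
  "smooth_fun A f \<Longrightarrow> (U, \<phi>) \<in> A \<Longrightarrow> smooth_on (\<phi> ` U) (\<lambda>x. f (inv_into U \<phi> x))"
  unfolding smooth_fun_def by (fastforce simp: o_def)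

lemma smooth_funI:
  "(\<And>U \<phi>. (U, \<phi>) \<in> A \<Longrightarrow> smooth_on (\<phi> ` U) (\<lambda>x. f (inv_into U \<phi> x))) \<Longrightarrow> smooth_fun A f"
  unfolding smooth_fun_def by (auto simp: o_def)

lemma smooth_fun_continuous:
  assumes "smooth_atlas A" "smooth_fun A f"
  shows "continuous_on UNIV f"
proof -
  have "isCont f p" for p
  proof -
    obtain U \<phi> where U: "(U, \<phi>) \<in> A" "p \<in> U" using obtain_chart[OF assms(1)] .
    have "continuous_on U (\<lambda>p. f (inv_into U \<phi> (\<phi> p)))"
      by (rule continuous_on_compose2[OF smooth_on_continuous_on[OF smooth_funD[OF assms(2) U(1)]]
            chart_continuous_on[OF assms(1) U(1)]]) auto
    then have "continuous_on U f"
      by (rule continuous_on_eq) (simp add: chart_inv[OF assms(1) U(1)])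
    then show ?thesis
      using U(2) open_chart_domain[OF assms(1) U(1)] continuous_on_eq_continuous_at by blast
  qed
  then show ?thesis by (simp add: continuous_at_imp_continuous_on)
qed

lemma smooth_fun_iff_smooth_map:
  fixes f :: "'m::{t2_space, second_countable_topology} \<Rightarrow> 'b::euclidean_space"
  assumes "smooth_atlas A"
  shows "smooth_fun A f \<longleftrightarrow> smooth_map A std_atlas f"
proof
  assume f: "smooth_fun A f"
  show "smooth_map A std_atlas f"
  proof (rule smooth_mapI[OF smooth_fun_continuous[OF assms f]])
    fix U \<phi> V and \<psi> :: "'b \<Rightarrow> 'b"
    assume "(U, \<phi>) \<in> A" "(V, \<psi>) \<in> std_atlas"
    then show "smooth_on (\<phi> ` (U \<inter> f -` V)) (\<lambda>x. \<psi> (f (inv_into U \<phi> x)))"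
      using smooth_funD[OF f] by (auto simp: std_atlas_def)
  qed
next
  assume f: "smooth_map A std_atlas f"
  show "smooth_fun A f"
  proof (rule smooth_funI)
    fix U \<phi> assume U: "(U, \<phi>) \<in> A"
    have "(UNIV, \<lambda>x. x) \<in> (std_atlas :: ('b, 'b) atlas)" by (simp add: std_atlas_def)
    from smooth_mapD[OF f U this] show "smooth_on (\<phi> ` U) (\<lambda>x. f (inv_into U \<phi> x))" by simp
  qed
qed

lemma smooth_fun_compose:
  fixes f :: "'n::{t2_space, second_countable_topology} \<Rightarrow> 'b::euclidean_space"
  assumes "smooth_atlas A" "smooth_atlas B" "smooth_map A B F" "smooth_fun B f"
  shows "smooth_fun A (\<lambda>x. f (F x))"
  using smooth_map_compose[OF assms(1,2) smooth_atlas_std assms(3)] assms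
  by (simp add: smooth_fun_iff_smooth_map)

text \<open>Splitting the inverse of the product chart exposes the two variables, so that partial
  derivatives can be taken in each.\<close>

lemma smooth_fun_prodD:
  assumes "smooth_atlas A" "smooth_atlas B" "smooth_fun (prod_atlas A B) W" "(U, \<phi>) \<in> A" "(V, \<psi>) \<in> B"
  shows "smooth_on (\<phi> ` U \<times> \<psi> ` V) (\<lambda>(x, y). W (inv_into U \<phi> x, inv_into V \<psi> y))"
proof -
  have "(U \<times> V, map_prod \<phi> \<psi>) \<in> prod_atlas A B"
    using assms(4,5) by (auto simp: prod_atlas_iff)
  from smooth_funD[OF assms(3) this]
  have "smooth_on (\<phi> ` U \<times> \<psi> ` V) (\<lambda>z. W (inv_into (U \<times> V) (map_prod \<phi> \<psi>) z))"
    by (simp add: map_prod_image)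
  then show ?thesis
    by (rule smooth_on_cong[rotated])
      (auto simp: inv_into_map_prod[OF chart_inj_on[OF assms(1,4)] chart_inj_on[OF assms(2,5)]]
        open_Times open_chart_image[OF assms(1,4)] open_chart_image[OF assms(2,5)])
qed

lemma smooth_fun_add:
  assumes "smooth_atlas A" "smooth_fun A f" "smooth_fun A g"
  shows "smooth_fun A (\<lambda>p. f p + g p)"
  by (rule smooth_funI) (intro smooth_on_add open_chart_image[OF assms(1)]
      smooth_funD[OF assms(2)] smooth_funD[OF assms(3)])

lemma smooth_fun_const: "smooth_fun A (\<lambda>_. c)"
  by (simp add: smooth_fun_def o_def smooth_on_const)

lemma smooth_fun_mult:
  fixes f g :: "'m::{t2_space, second_countable_topology} \<Rightarrow> 'b::real_normed_algebra"
  assumes "smooth_atlas A" "smooth_fun A f" "smooth_fun A g"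
  shows "smooth_fun A (\<lambda>p. f p * g p)"
  by (rule smooth_funI) (intro smooth_on_mult open_chart_image[OF assms(1)]
      smooth_funD[OF assms(2)] smooth_funD[OF assms(3)])

lemma smooth_fun_bounded_linear:
  assumes "smooth_atlas A" "bounded_linear h" "smooth_fun A f"
  shows "smooth_fun A (\<lambda>p. h (f p))"
  by (rule smooth_funI)
    (rule smooth_on_bounded_linear_comp[OF assms(2) open_chart_image[OF assms(1)] smooth_funD[OF assms(3)]])

section \<open>Differential operators\<close>

lemma diff_op_smooth:
  assumes "smooth_atlas A" "diff_op A D" "smooth_fun A f"
  shows "smooth_fun A (D f)"
proof (rule smooth_funI)
  fix U \<phi> assume U: "(U, \<phi>) \<in> A"
  note o = open_chart_image[OF assms(1) U]
  obtain k a where a: "\<And>I. I \<in> basis_words k \<Longrightarrow> smooth_on (\<phi> ` U) (a I)"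
    and D: "\<And>p. p \<in> U \<Longrightarrow> D f p =
      (\<Sum>I\<in>basis_words k. a I (\<phi> p) * iter_deriv I (f \<circ> inv_into U \<phi>) (\<phi> p))"
    using assms(2,3) U unfolding diff_op_def by fast
  have "smooth_on (\<phi> ` U) (\<lambda>x. \<Sum>I\<in>basis_words k. a I x * iter_deriv I (f \<circ> inv_into U \<phi>) x)"
    using smooth_funD[OF assms(3) U]
    by (intro smooth_on_sum o smooth_on_mult a smooth_on_iter_deriv) (simp_all add: o_def)
  then show "smooth_on (\<phi> ` U) (\<lambda>x. D f (inv_into U \<phi> x))"
    by (rule smooth_on_cong[OF o]) (auto simp: D chart_inv[OF assms(1) U])
qed

lemma diff_op_add:
  assumes "smooth_atlas A" "diff_op A D" "smooth_fun A f" "smooth_fun A g"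
  shows "D (\<lambda>p. f p + g p) = (\<lambda>p. D f p + D g p)"
proof
  fix p
  obtain U \<phi> where U: "(U, \<phi>) \<in> A" "p \<in> U" using obtain_chart[OF assms(1)] .
  \<comment> \<open>\<open>diff_op\<close> fixes the coefficients before the function, so one choice
    of \<open>a\<close> serves \<open>f\<close>, \<open>g\<close> and their sum.\<close>
  obtain k a where D: "\<And>f. smooth_fun A f \<Longrightarrow> D f p =
      (\<Sum>I\<in>basis_words k. a I (\<phi> p) * iter_deriv I (f \<circ> inv_into U \<phi>) (\<phi> p))"
    using assms(2) U unfolding diff_op_def by fast
  have *: "iter_deriv I ((\<lambda>p. f p + g p) \<circ> inv_into U \<phi>) (\<phi> p) =
      iter_deriv I (f \<circ> inv_into U \<phi>) (\<phi> p) + iter_deriv I (g \<circ> inv_into U \<phi>) (\<phi> p)" for I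
    using iter_deriv_add[OF open_chart_image[OF assms(1) U(1)] imageI[OF U(2)]
        smooth_funD[OF assms(3) U(1)] smooth_funD[OF assms(4) U(1)]]
    by (simp add: o_def)
  then show "D (\<lambda>p. f p + g p) p = D f p + D g p"
    unfolding D[OF smooth_fun_add[OF assms(1,3,4)]] D[OF assms(3)] D[OF assms(4)] *
    by (simp add: algebra_simps sum.distrib)
qed

section \<open>Coordinate derivations\<close>

text \<open>The partial derivative along \<open>b\<close> in the chart; the value 0 off the smooth
  functions is the normal form that \<open>tangent_space\<close> demands.\<close>

definition coord_vec :: "('m, 'e::euclidean_space) atlas \<Rightarrow> 'm set \<Rightarrow> ('m \<Rightarrow> 'e) \<Rightarrow> 'm \<Rightarrow> 'e \<Rightarrow> 'm tangent" where
  "coord_vec A U \<phi> p b = (\<lambda>f. if smooth_fun A f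
     then frechet_derivative (\<lambda>x. f (inv_into U \<phi> x)) (at (\<phi> p)) b else 0)"

lemma coord_vec_tangent_space:
  assumes A: "smooth_atlas A" and U: "(U, \<phi>) \<in> A" "p \<in> U"
  shows "coord_vec A U \<phi> p b \<in> tangent_space A p"
proof -
  have d: "((\<lambda>x. f (inv_into U \<phi> x)) has_derivative
      frechet_derivative (\<lambda>x. f (inv_into U \<phi> x)) (at (\<phi> p))) (at (\<phi> p))"
    if "smooth_fun A f" for f :: "'a \<Rightarrow> real"
    using smooth_on_has_derivative[OF smooth_funD[OF that U(1)]] U(2) by blast
  have "coord_vec A U \<phi> p b (\<lambda>q. r * f q + s * g q) =
      r * coord_vec A U \<phi> p b f + s * coord_vec A U \<phi> p b g"
    if "smooth_fun A f" "smooth_fun A g" for f g :: "'a \<Rightarrow> real" and r s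
  proof -
    have "smooth_fun A (\<lambda>q. r * f q + s * g q)"
      by (intro smooth_fun_add smooth_fun_mult smooth_fun_const A that)
    moreover have "frechet_derivative (\<lambda>x. r * f (inv_into U \<phi> x) + s * g (inv_into U \<phi> x)) (at (\<phi> p)) =
        (\<lambda>b. r * frechet_derivative (\<lambda>x. f (inv_into U \<phi> x)) (at (\<phi> p)) b
           + s * frechet_derivative (\<lambda>x. g (inv_into U \<phi> x)) (at (\<phi> p)) b)"
      by (intro frechet_derivative_at[symmetric] has_derivative_add has_derivative_mult_right d that)
    ultimately show ?thesis using that by (simp add: coord_vec_def)
  qed
  moreover have "coord_vec A U \<phi> p b (\<lambda>q. f q * g q) =
      coord_vec A U \<phi> p b f * g p + f p * coord_vec A U \<phi> p b g"
    if "smooth_fun A f" "smooth_fun A g" for f g :: "'a \<Rightarrow> real"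
  proof -
    have "smooth_fun A (\<lambda>q. f q * g q)"
      by (intro smooth_fun_mult A that)
    moreover have "frechet_derivative (\<lambda>x. f (inv_into U \<phi> x) * g (inv_into U \<phi> x)) (at (\<phi> p)) =
        (\<lambda>b. f (inv_into U \<phi> (\<phi> p)) * frechet_derivative (\<lambda>x. g (inv_into U \<phi> x)) (at (\<phi> p)) b
           + frechet_derivative (\<lambda>x. f (inv_into U \<phi> x)) (at (\<phi> p)) b * g (inv_into U \<phi> (\<phi> p)))"
      by (intro frechet_derivative_at[symmetric] has_derivative_mult d that)
    ultimately show ?thesis using that U(2) by (simp add: coord_vec_def chart_inv[OF A U(1)])
  qed
  ultimately show ?thesis unfolding tangent_space_def by (simp add: coord_vec_def)
qed

lemma cderiv_coord_vec:
  assumes A: "smooth_atlas A" and U: "(U, \<phi>) \<in> A" "p \<in> U" and u: "smooth_fun A u"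
  shows "cderiv (coord_vec A U \<phi> p b) u = frechet_derivative (\<lambda>x. u (inv_into U \<phi> x)) (at (\<phi> p)) b"
proof -
  have s: "smooth_fun A (\<lambda>q. Re (u q))" "smooth_fun A (\<lambda>q. Im (u q))"
    using smooth_fun_bounded_linear[OF A bounded_linear_Re u]
      smooth_fun_bounded_linear[OF A bounded_linear_Im u] by auto
  note e = frechet_derivative_bounded_linear_comp[OF _ smooth_funD[OF u U(1)] imageI[OF U(2)]]
  show ?thesis
    using s e[OF bounded_linear_Re, of b] e[OF bounded_linear_Im, of b]
    by (simp add: cderiv_def coord_vec_def o_def)
qed


section \<open>Smooth actions of Lie groups\<close>

locale lie_action =
  fixes AG :: "('g::{t2_space, second_countable_topology}, 'd::euclidean_space) atlas"
    and G :: "'g monoid"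
    and AM :: "('m::{t2_space, second_countable_topology}, 'e::euclidean_space) atlas"
    and act :: "'g \<Rightarrow> 'm \<Rightarrow> 'm"
  assumes lie: "lie_group AG G" and atlas_M: "smooth_atlas AM" and action: "smooth_action AG G AM act"
begin

lemma atlas_G: "smooth_atlas AG"
  and group_G: "group G"
  and carrier_G [simp]: "carrier G = UNIV"
  using lie unfolding lie_group_def by auto

lemma act_one: "act \<one>\<^bsub>G\<^esub> p = p"
proof -
  interpret group_action G UNIV act using action unfolding smooth_action_def by simp
  show ?thesis using id_eq_one by (metis UNIV_I restrict_apply')
qed

lemma act_mult: "act (g \<otimes>\<^bsub>G\<^esub> h) p = act g (act h p)"
proof -
  interpret group_action G UNIV act using action unfolding smooth_action_def by simp
  show ?thesis using composition_rule by simp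
qed

text \<open>Stated for two maps into the group rather than for multiplication itself. With inversion
  and the action in the same form, smoothness of any expression built from them follows its
  syntax.\<close>

lemma smooth_map_mult:
  assumes B: "smooth_atlas B" and F: "smooth_map B AG F" and K: "smooth_map B AG K"
  shows "smooth_map B AG (\<lambda>x. F x \<otimes>\<^bsub>G\<^esub> K x)"
proof -
  have m: "smooth_map (prod_atlas AG AG) AG (\<lambda>(g, h). g \<otimes>\<^bsub>G\<^esub> h)"
    using lie unfolding lie_group_def by simp
  show ?thesis
    using smooth_map_compose[OF B smooth_atlas_prod[OF atlas_G atlas_G] atlas_G
        smooth_map_Pair[OF B atlas_G atlas_G F K] m] by simp
qed

lemma smooth_map_inv:
  assumes B: "smooth_atlas B" and F: "smooth_map B AG F"
  shows "smooth_map B AG (\<lambda>x. inv\<^bsub>G\<^esub> F x)"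
  using smooth_map_compose[OF B atlas_G atlas_G F] lie unfolding lie_group_def by blast

lemma smooth_map_act:
  assumes B: "smooth_atlas B" and F: "smooth_map B AG F" and K: "smooth_map B AM K"
  shows "smooth_map B AM (\<lambda>x. act (F x) (K x))"
proof -
  have m: "smooth_map (prod_atlas AG AM) AM (\<lambda>(g, p). act g p)"
    using action unfolding smooth_action_def by simp
  show ?thesis
    using smooth_map_compose[OF B smooth_atlas_prod[OF atlas_G atlas_M] atlas_M
        smooth_map_Pair[OF B atlas_G atlas_M F K] m] by simp
qed

lemma smooth_fun_act_fun:
  fixes u :: "'m \<Rightarrow> complex"
  assumes "smooth_fun AM u"
  shows "smooth_fun AM (act_fun G act g u)"
  unfolding act_fun_def
  by (rule smooth_fun_compose[OF atlas_M atlas_M _ assms])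
    (intro smooth_map_act smooth_map_const smooth_map_ident atlas_M)

lemma act_fun_one: "act_fun G act \<one>\<^bsub>G\<^esub> u = u"
  using group.is_monoid[OF group_G] by (simp add: act_fun_def monoid.inv_one act_one)

lemma act_fun_mult: "act_fun G act (g \<otimes>\<^bsub>G\<^esub> h) u = act_fun G act g (act_fun G act h u)"
  by (simp add: act_fun_def group.inv_mult_group[OF group_G] act_mult)

lemma smooth_fun_left_translation:
  fixes f :: "'g \<Rightarrow> real"
  assumes "smooth_fun AG f"
  shows "smooth_fun AG (\<lambda>q. f (g \<otimes>\<^bsub>G\<^esub> q))"
  by (rule smooth_fun_compose[OF atlas_G atlas_G _ assms])
    (intro smooth_map_mult smooth_map_const smooth_map_ident atlas_G)

section \<open>Left invariant fields and derivatives at the unit\<close>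

context
  fixes U :: "'g set" and \<phi> :: "'g \<Rightarrow> 'd"
  assumes U: "(U, \<phi>) \<in> AG" "\<one>\<^bsub>G\<^esub> \<in> U"
begin

text \<open>The left invariant extension of a coordinate vector at the unit. It is needed because
  the hypotheses speak of elements of \<open>lie_algebra\<close>, while \<open>inf_act\<close> sees
  only their value at the unit.\<close>

definition left_field :: "'d \<Rightarrow> 'g vfield" where
  "left_field b = (\<lambda>g. pushforward AG (\<lambda>q. g \<otimes>\<^bsub>G\<^esub> q) (coord_vec AG U \<phi> \<one>\<^bsub>G\<^esub> b))"

lemma left_field_one: "left_field b \<one>\<^bsub>G\<^esub> = coord_vec AG U \<phi> \<one>\<^bsub>G\<^esub> b"
  using group.is_monoid[OF group_G]
  by (auto simp: left_field_def pushforward_def o_def coord_vec_def monoid.l_one)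

lemma left_field_in_lie_algebra: "left_field b \<in> lie_algebra AG G"
proof -
  interpret group G by (rule group_G)
  have v: "coord_vec AG U \<phi> \<one>\<^bsub>G\<^esub> b \<in> tangent_space AG \<one>\<^bsub>G\<^esub>" (is "?v \<in> _")
    by (rule coord_vec_tangent_space[OF atlas_G U])
  have app: "left_field b g f = ?v (\<lambda>q. f (g \<otimes>\<^bsub>G\<^esub> q))" if "smooth_fun AG f" for g f
    using that by (simp add: left_field_def pushforward_def o_def)
  have "left_field b g \<in> tangent_space AG g" for g
    unfolding tangent_space_def
  proof (intro CollectI conjI allI impI)
    fix f k :: "'g \<Rightarrow> real" and r s assume fk: "smooth_fun AG f" "smooth_fun AG k"
    have "smooth_fun AG (\<lambda>q. r * f q + s * k q)"
      by (intro smooth_fun_add smooth_fun_mult smooth_fun_const atlas_G fk)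
    then show "left_field b g (\<lambda>q. r * f q + s * k q) = r * left_field b g f + s * left_field b g k"
      using v smooth_fun_left_translation[OF fk(1)] smooth_fun_left_translation[OF fk(2)]
      unfolding tangent_space_def by (simp add: app fk)
  next
    fix f k :: "'g \<Rightarrow> real" assume fk: "smooth_fun AG f" "smooth_fun AG k"
    have "smooth_fun AG (\<lambda>q. f q * k q)"
      by (intro smooth_fun_mult atlas_G fk)
    then show "left_field b g (\<lambda>q. f q * k q) = left_field b g f * k g + f g * left_field b g k"
      using v smooth_fun_left_translation[OF fk(1)] smooth_fun_left_translation[OF fk(2)]
      unfolding tangent_space_def by (simp add: app fk)
  qed (simp add: left_field_def pushforward_def)
  \<comment> \<open>The field applied to \<open>f\<close> differentiates f(g q) in q at the unit. In
    charts this is the derivative along (0, b) of a jointly smooth function, hence smooth in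
    g.\<close>
  moreover have "smooth_fun AG (\<lambda>g. left_field b g f)" if f: "smooth_fun AG f" for f
  proof (rule smooth_funI)
    fix V \<psi> assume V: "(V, \<psi>) \<in> AG"
    note oV = open_chart_image[OF atlas_G V]
    let ?i = "inv_into U \<phi>" and ?j = "inv_into V \<psi>"
    have AA: "smooth_atlas (prod_atlas AG AG)" by (intro smooth_atlas_prod atlas_G)
    have "smooth_fun (prod_atlas AG AG) (\<lambda>z. f (fst z \<otimes>\<^bsub>G\<^esub> snd z))"
      by (rule smooth_fun_compose[OF AA atlas_G _ f])
        (intro smooth_map_mult smooth_map_fst smooth_map_snd atlas_G AA)
    from smooth_fun_prodD[OF atlas_G atlas_G this V U(1)]
    have s: "smooth_on (\<psi> ` V \<times> \<phi> ` U) (\<lambda>(x, y). f (?j x \<otimes>\<^bsub>G\<^esub> ?i y))" (is "smooth_on _ ?w") by simp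
    have eq: "frechet_derivative ?w (at (x, \<phi> \<one>\<^bsub>G\<^esub>)) (0, b) = left_field b (?j x) f" if "x \<in> \<psi> ` V" for x
    proof -
      have 1: "((\<lambda>y. (x, y)) has_derivative (\<lambda>v. (0, v))) (at (\<phi> \<one>\<^bsub>G\<^esub>))"
        by (auto intro!: derivative_eq_intros)
      have 2: "(?w has_derivative frechet_derivative ?w (at (x, \<phi> \<one>\<^bsub>G\<^esub>))) (at (x, \<phi> \<one>\<^bsub>G\<^esub>))"
        by (rule smooth_on_has_derivative[OF s]) (use that U in auto)
      have "frechet_derivative (\<lambda>y. f (?j x \<otimes>\<^bsub>G\<^esub> ?i y)) (at (\<phi> \<one>\<^bsub>G\<^esub>)) =
          (\<lambda>v. frechet_derivative ?w (at (x, \<phi> \<one>\<^bsub>G\<^esub>)) (0, v))"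
        using diff_chain_at[OF 1 2] by (intro frechet_derivative_at[symmetric]) (simp add: o_def)
      then show ?thesis
        by (simp add: app[OF f] coord_vec_def smooth_fun_left_translation[OF f])
    qed
    have "smooth_on (\<psi> ` V) (\<lambda>x. (x, \<phi> \<one>\<^bsub>G\<^esub>))"
      by (intro smooth_on_Pair oV smooth_on_const smooth_on_bounded_linear bounded_linear_ident)
    from smooth_on_compose[OF oV this smooth_on_frechet_derivative[OF s, of "(0, b)"]]
    have "smooth_on (\<psi> ` V) (\<lambda>x. frechet_derivative ?w (at (x, \<phi> \<one>\<^bsub>G\<^esub>)) (0, b))"
      using U(2) by auto
    then show "smooth_on (\<psi> ` V) (\<lambda>x. left_field b (?j x) f)"
      by (rule smooth_on_cong[OF oV]) (rule eq)
  qed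
  ultimately have "vector_field AG (left_field b)" unfolding vector_field_def by blast
  moreover have "pushforward AG (\<lambda>q. g \<otimes>\<^bsub>G\<^esub> q) (left_field b h) = left_field b (g \<otimes>\<^bsub>G\<^esub> h)" for g h
    by (rule ext)
      (simp add: pushforward_def left_field_def o_def smooth_fun_left_translation m_assoc)
  ultimately show ?thesis unfolding lie_algebra_def by blast
qed

lemma inf_act_left_field:
  fixes u :: "'m \<Rightarrow> complex"
  assumes "smooth_fun AM u"
  shows "inf_act G act (left_field b) u p =
    frechet_derivative (\<lambda>x. u (act (inv\<^bsub>G\<^esub> (inv_into U \<phi> x)) p)) (at (\<phi> \<one>\<^bsub>G\<^esub>)) b"
proof -
  have "smooth_fun AG (\<lambda>g. u (act (inv\<^bsub>G\<^esub> g) p))"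
    by (rule smooth_fun_compose[OF atlas_G atlas_M _ assms])
      (intro smooth_map_act smooth_map_inv smooth_map_const smooth_map_ident atlas_G)
  from cderiv_coord_vec[OF atlas_G U this] show ?thesis
    by (simp add: inf_act_def left_field_one act_fun_def)
qed

text \<open>
  The two partial derivatives of \<open>u (x\<inverse> y q)\<close> at \<open>x = y = 1\<close> cancel because this function is
  constant on the diagonal; this avoids differentiating the inversion.
\<close>

lemma has_derivative_orbit:
  fixes u :: "'m \<Rightarrow> complex"
  assumes u: "smooth_fun AM u"
  shows "((\<lambda>x. u (act (inv_into U \<phi> x) q)) has_derivative
    (\<lambda>b. - inf_act G act (left_field b) u q)) (at (\<phi> \<one>\<^bsub>G\<^esub>))"
proof -
  interpret group G by (rule group_G)
  let ?i = "inv_into U \<phi>" and ?x0 = "\<phi> \<one>\<^bsub>G\<^esub>"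
  have AA: "smooth_atlas (prod_atlas AG AG)" by (intro smooth_atlas_prod atlas_G)
  have i0: "?i ?x0 = \<one>\<^bsub>G\<^esub>" by (rule chart_inv[OF atlas_G U])
  have "smooth_fun (prod_atlas AG AG) (\<lambda>z. u (act (inv\<^bsub>G\<^esub> fst z) (act (snd z) q)))"
    by (rule smooth_fun_compose[OF AA atlas_M _ u])
      (intro smooth_map_act smooth_map_inv smooth_map_const smooth_map_fst smooth_map_snd atlas_G AA)
  from smooth_fun_prodD[OF atlas_G atlas_G this U(1) U(1)]
  have s: "smooth_on (\<phi> ` U \<times> \<phi> ` U) (\<lambda>(x, y). u (act (inv\<^bsub>G\<^esub> ?i x) (act (?i y) q)))"
    (is "smooth_on _ ?w") by simp
  define L where "L = frechet_derivative ?w (at (?x0, ?x0))"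
  have L: "(?w has_derivative L) (at (?x0, ?x0))"
    unfolding L_def by (rule smooth_on_has_derivative[OF s]) (use U in auto)
  have "((\<lambda>x. (x, x)) has_derivative (\<lambda>b. (b, b))) (at ?x0)"
    by (auto intro!: derivative_eq_intros)
  from diff_chain_at[OF this L]
  have "((\<lambda>x. u (act (inv\<^bsub>G\<^esub> ?i x) (act (?i x) q))) has_derivative (\<lambda>b. L (b, b))) (at ?x0)"
    by (simp add: o_def)
  then have "((\<lambda>x. u q) has_derivative (\<lambda>b. L (b, b))) (at ?x0)"
    by (simp add: act_mult[symmetric] act_one)
  then have "(\<lambda>b. L (b, b)) = (\<lambda>b. 0)"
    using has_derivative_unique has_derivative_const by blast
  then have z: "L (b, b) = 0" for b by metis
  have "((\<lambda>x. (x, ?x0)) has_derivative (\<lambda>b. (b, 0))) (at ?x0)"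
    by (auto intro!: derivative_eq_intros)
  from diff_chain_at[OF this L]
  have "((\<lambda>x. u (act (inv\<^bsub>G\<^esub> ?i x) q)) has_derivative (\<lambda>b. L (b, 0))) (at ?x0)"
    by (simp add: o_def i0 act_one)
  then have x: "inf_act G act (left_field b) u q = L (b, 0)" for b
    using frechet_derivative_at inf_act_left_field[OF u] by metis
  have "((\<lambda>x. (?x0, x)) has_derivative (\<lambda>b. (0, b))) (at ?x0)"
    by (auto intro!: derivative_eq_intros)
  from diff_chain_at[OF this L]
  have "((\<lambda>x. u (act (?i x) q)) has_derivative (\<lambda>b. L (0, b))) (at ?x0)"
    by (simp add: o_def i0 act_one)
  moreover have "L (0, b) = - inf_act G act (left_field b) u q" for b
  proof -
    have "L ((b, 0) + (0, b)) = L (b, 0) + L (0, b)"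
      using has_derivative_linear[OF L] by (rule linear_add)
    then show ?thesis using z[of b] x[of b] by (simp add: add_eq_0_iff)
  qed
  ultimately show ?thesis by simp
qed

text \<open>As \<open>x\<close> occurs twice, the expression is written as
  \<open>H (x, c x)\<close>, where \<open>H\<close> keeps the group variable and the point apart and
  \<open>c x\<close> is the coordinate of the moved point. Along \<open>b\<close> its derivative is
  D (X v) - X (D v) at \<open>q\<close> with X = \<open>left_field b\<close>, which vanishes by
  \<open>comm\<close>. Smoothness of X f is part of \<open>comm\<close> because the coordinate
  formula for \<open>D\<close> covers smooth functions only.\<close>

lemma has_derivative_conjugate_at_one:
  fixes v :: "'m \<Rightarrow> complex"
  assumes D: "diff_op AM D" and v: "smooth_fun AM v"
    and comm: "\<And>X f. X \<in> lie_algebra AG G \<Longrightarrow> smooth_fun AM f \<Longrightarrow>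
      smooth_fun AM (inf_act G act X f) \<and> D (inf_act G act X f) = inf_act G act X (D f)"
  shows "((\<lambda>x. D (act_fun G act (inv_into U \<phi> x) v) (act (inv_into U \<phi> x) q)) has_derivative (\<lambda>_. 0))
    (at (\<phi> \<one>\<^bsub>G\<^esub>))"
proof -
  interpret group G by (rule group_G)
  let ?x0 = "\<phi> \<one>\<^bsub>G\<^esub>"
  define i where "i = inv_into U \<phi>"
  have i0: "i ?x0 = \<one>\<^bsub>G\<^esub>" unfolding i_def by (rule chart_inv[OF atlas_G U])
  obtain V \<psi> where V: "(V, \<psi>) \<in> AM" "q \<in> V" using obtain_chart[OF atlas_M] .
  define j where "j = inv_into V \<psi>"
  define O1 where "O1 = \<phi> ` U"
  define P where "P = \<psi> ` V"
  have O1: "open O1" "?x0 \<in> O1" using open_chart_image[OF atlas_G U(1)] U(2) by (auto simp: O1_def)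
  have P: "open P" "\<psi> q \<in> P" using open_chart_image[OF atlas_M V(1)] V(2) by (auto simp: P_def)
  have j: "j y \<in> V" "\<psi> (j y) = y" if "y \<in> P" for y
    using that by (auto simp: P_def j_def inv_into_into f_inv_into_f)
  obtain k a where a: "\<And>I. I \<in> basis_words k \<Longrightarrow> smooth_on P (a I)"
    and Df: "\<And>f p. smooth_fun AM f \<Longrightarrow> p \<in> V \<Longrightarrow> D f p =
      (\<Sum>I\<in>basis_words k. a I (\<psi> p) * iter_deriv I (f \<circ> j) (\<psi> p))"
    using D V(1) unfolding diff_op_def P_def j_def by fast
  have GM: "smooth_atlas (prod_atlas AG AM)" by (intro smooth_atlas_prod atlas_G atlas_M)
  have "smooth_fun (prod_atlas AG AM) (\<lambda>z. v (act (inv\<^bsub>G\<^esub> fst z) (snd z)))"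
    by (rule smooth_fun_compose[OF GM atlas_M _ v])
      (intro smooth_map_act smooth_map_inv smooth_map_fst smooth_map_snd atlas_G atlas_M GM)
  from smooth_fun_prodD[OF atlas_G atlas_M this U(1) V(1)]
  have w: "smooth_on (O1 \<times> P) (\<lambda>(x, y). v (act (inv\<^bsub>G\<^esub> i x) (j y)))" (is "smooth_on _ ?w")
    by (simp add: O1_def P_def i_def j_def)
  have OP: "open (O1 \<times> P)" using O1 P by (simp add: open_Times)
  let ?z = "\<lambda>I. map (Pair (0::'d)) I"
  \<comment> \<open>\<open>D\<close> in coordinates, acting in the second variable: each letter b of
    a word becomes (0, b). In this form smoothness in both variables together is visible.\<close>
  define H where "H = (\<lambda>z. \<Sum>I\<in>basis_words k. a I (snd z) * iter_deriv (?z I) ?w z)"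
  have H: "smooth_on (O1 \<times> P) H"
    unfolding H_def
  proof (intro smooth_on_sum OP smooth_on_mult smooth_on_iter_deriv w)
    fix I :: "'e list" assume "I \<in> basis_words k"
    from smooth_on_compose[OF OP smooth_on_bounded_linear[OF bounded_linear_snd] a[OF this]]
    show "smooth_on (O1 \<times> P) (\<lambda>z. a I (snd z))" by auto
  qed
  have H_eq: "H (x, y) = D (act_fun G act (i x) v) (j y)" if "x \<in> O1" "y \<in> P" for x y
  proof -
    have "iter_deriv I (act_fun G act (i x) v \<circ> j) y = iter_deriv (?z I) ?w (x, y)" for I
      using iter_deriv_Pair_zero[OF O1(1) P(1) w that, of I] by (simp add: act_fun_def o_def)
    then show ?thesis
      using Df[OF smooth_fun_act_fun[OF v] j(1)[OF that(2)]] by (simp add: H_def j(2)[OF that(2)])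
  qed
  define L where "L = frechet_derivative H (at (?x0, \<psi> q))"
  have L: "(H has_derivative L) (at (?x0, \<psi> q))"
    unfolding L_def by (rule smooth_on_has_derivative[OF H]) (use O1 P in auto)

  \<comment> \<open>Group direction, with the point fixed: the coefficients depend on the point
    only, so just the iterated derivatives are differentiated.\<close>
  have L1: "L (b, 0) = D (inf_act G act (left_field b) v) q" for b
  proof -
    have 1: "((\<lambda>x. (x, y)) has_derivative (\<lambda>b. (b, 0))) (at ?x0)" for y :: 'e
      by (auto intro!: derivative_eq_intros)
    define F where "F = (\<lambda>I. frechet_derivative (iter_deriv (?z I) ?w) (at (?x0, \<psi> q)))"
    have dF: "((\<lambda>x. iter_deriv (?z I) ?w (x, \<psi> q)) has_derivative (\<lambda>b. F I (b, 0))) (at ?x0)" for I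
      using diff_chain_at[OF 1 smooth_on_has_derivative[OF smooth_on_iter_deriv[OF w]]] O1 P
      by (simp add: o_def F_def)
    have "((\<lambda>x. H (x, \<psi> q)) has_derivative
        (\<lambda>b. \<Sum>I\<in>basis_words k. a I (\<psi> q) * F I (b, 0))) (at ?x0)"
      unfolding H_def snd_conv by (intro has_derivative_sum has_derivative_mult_right dF)
    moreover have "((\<lambda>x. H (x, \<psi> q)) has_derivative (\<lambda>b. L (b, 0))) (at ?x0)"
      using diff_chain_at[OF 1 L] by (simp add: o_def)
    ultimately have "(\<lambda>b. L (b, 0)) = (\<lambda>b. \<Sum>I\<in>basis_words k. a I (\<psi> q) * F I (b, 0))"
      using has_derivative_unique by blast
    then have L_sum: "L (b, 0) = (\<Sum>I\<in>basis_words k. a I (\<psi> q) * F I (b, 0))" by metis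
    let ?w' = "\<lambda>z. frechet_derivative ?w (at z) (b, 0)"
    have w': "smooth_on (O1 \<times> P) ?w'" by (rule smooth_on_frechet_derivative[OF w])
    have "?w' (?x0, y) = inf_act G act (left_field b) v (j y)" if "y \<in> P" for y
    proof -
      have "(?w has_derivative frechet_derivative ?w (at (?x0, y))) (at (?x0, y))"
        by (rule smooth_on_has_derivative[OF w]) (use O1 that in auto)
      from diff_chain_at[OF 1 this]
      have "((\<lambda>x. v (act (inv\<^bsub>G\<^esub> i x) (j y))) has_derivative
          (\<lambda>b. frechet_derivative ?w (at (?x0, y)) (b, 0))) (at ?x0)"
        by (simp add: o_def)
      then show ?thesis
        using frechet_derivative_at inf_act_left_field[OF v] unfolding i_def by metis
    qed
    note w'_eq = this
    have "smooth_on P (\<lambda>y. (?x0, y))"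
      by (intro smooth_on_Pair P smooth_on_const smooth_on_bounded_linear bounded_linear_ident)
    from smooth_on_compose[OF P(1) this w'] have w'x: "smooth_on P (\<lambda>y. ?w' (?x0, y))"
      using O1 by auto
    \<comment> \<open>The derivative along the group is moved inside those along the manifold, where
      it turns v(x^-1 y) into X v.\<close>
    have "F I (b, 0) = iter_deriv I (inf_act G act (left_field b) v \<circ> j) (\<psi> q)" for I
    proof -
      have "F I (b, 0) = iter_deriv (?z I) ?w' (?x0, \<psi> q)"
        unfolding F_def using iter_deriv_frechet_derivative[OF OP _ w] O1 P by simp
      also have "\<dots> = iter_deriv I (\<lambda>y. ?w' (?x0, y)) (\<psi> q)"
        by (rule iter_deriv_Pair_zero[OF O1(1) P(1) w' O1(2) P(2), symmetric])
      also have "\<dots> = iter_deriv I (inf_act G act (left_field b) v \<circ> j) (\<psi> q)"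
        by (rule iter_deriv_cong[OF P w'x]) (simp add: w'_eq)
      finally show ?thesis .
    qed
    then show ?thesis
      using Df[OF conjunct1[OF comm[OF left_field_in_lie_algebra v]] V(2)] by (simp add: L_sum)
  qed

  \<comment> \<open>The \<open>x\<close> for which the moved point stays in the chart
    \<open>V\<close>; only there is \<open>c x\<close> its coordinate.\<close>
  define N where "N = \<phi> ` (U \<inter> (\<lambda>h. act h q) -` V)"
  have m: "smooth_map AG AM (\<lambda>h. act h q)"
    by (intro smooth_map_act smooth_map_const smooth_map_ident atlas_G)
  have N: "open N" "?x0 \<in> N"
    unfolding N_def using U(2) V(2) act_one
    by (auto intro!: open_chart_image_Int[OF atlas_G U(1)]
        open_vimage[OF open_chart_domain[OF atlas_M V(1)] smooth_map_continuous[OF m]])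
  define c where "c = (\<lambda>x. \<psi> (act (i x) q))"
  have c0: "c ?x0 = \<psi> q" by (simp add: c_def i0 act_one)
  have "smooth_on N c" unfolding N_def c_def i_def by (rule smooth_mapD[OF m U(1) V(1)])
  then obtain c' where c': "(c has_derivative c') (at ?x0)"
    using smooth_on_has_derivative N(2) by blast
  have NO: "x \<in> O1" "c x \<in> P" "j (c x) = act (i x) q" if "x \<in> N" for x
    using that chart_inv[OF atlas_G U(1)] chart_inv[OF atlas_M V(1)]
    by (auto simp: N_def O1_def P_def c_def i_def j_def)

  \<comment> \<open>Point direction, with the group variable frozen at the unit: there
    \<open>H\<close> is \<open>D v\<close> along the orbit of \<open>q\<close>, and the sign comes
    from the inverse in the action on functions.\<close>
  have L2: "L (0, c' b) = - inf_act G act (left_field b) (D v) q" for b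
  proof -
    have "((\<lambda>x. (?x0, c x)) has_derivative (\<lambda>b. (0, c' b))) (at ?x0)"
      by (intro has_derivative_Pair has_derivative_const c')
    from diff_chain_at[OF this] L
    have "((\<lambda>x. H (?x0, c x)) has_derivative (\<lambda>b. L (0, c' b))) (at ?x0)"
      by (simp add: o_def c0)
    then have "((\<lambda>x. D v (act (i x) q)) has_derivative (\<lambda>b. L (0, c' b))) (at ?x0)"
      by (rule has_derivative_transform_within_open[OF _ N])
        (simp add: H_eq[OF O1(2) NO(2)] NO(3) i0 act_fun_one)
    then show ?thesis
      using has_derivative_orbit[OF diff_op_smooth[OF atlas_M D v], of q] has_derivative_unique
      unfolding i_def by metis
  qed
  have zero: "L (b, c' b) = 0" for b
  proof -
    have "L ((b, 0) + (0, c' b)) = L (b, 0) + L (0, c' b)"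
      using has_derivative_linear[OF L] by (rule linear_add)
    then show ?thesis
      using comm[OF left_field_in_lie_algebra v] by (simp add: L1 L2)
  qed
  have "((\<lambda>x. (x, c x)) has_derivative (\<lambda>b. (b, c' b))) (at ?x0)"
    by (intro has_derivative_Pair has_derivative_ident c')
  from diff_chain_at[OF this] L
  have "((\<lambda>x. H (x, c x)) has_derivative (\<lambda>b. L (b, c' b))) (at ?x0)"
    by (simp add: o_def c0)
  then have "((\<lambda>x. H (x, c x)) has_derivative (\<lambda>b. 0)) (at ?x0)"
    by (simp only: zero)
  then have "((\<lambda>x. D (act_fun G act (i x) v) (act (i x) q)) has_derivative (\<lambda>b. 0)) (at ?x0)"
    by (rule has_derivative_transform_within_open[OF _ N]) (simp add: H_eq NO)
  then show ?thesis unfolding i_def .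
qed

end

text \<open>Vanishing of the derivative at \<open>g\<close> alone would not give constancy near
  \<open>g\<close>. Since the result at the unit holds for every function and every point, it can be
  applied at each \<open>h\<close> of a chart around \<open>g\<close>.\<close>

lemma conjugate_locally_constant:
  fixes u :: "'m \<Rightarrow> complex"
  assumes D: "diff_op AM D" and u: "smooth_fun AM u"
    and comm: "\<And>X f. X \<in> lie_algebra AG G \<Longrightarrow> smooth_fun AM f \<Longrightarrow>
      smooth_fun AM (inf_act G act X f) \<and> D (inf_act G act X f) = inf_act G act X (D f)"
  shows "eventually (\<lambda>h. D (act_fun G act g u) (act g p) = D (act_fun G act h u) (act h p)) (at g)"
proof -
  interpret group G by (rule group_G)
  define F where "F = (\<lambda>g. D (act_fun G act g u) (act g p))"
  obtain U \<phi> where U: "(U, \<phi>) \<in> AG" "\<one>\<^bsub>G\<^esub> \<in> U" using obtain_chart[OF atlas_G] .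
  obtain V \<psi> where V: "(V, \<psi>) \<in> AG" "g \<in> V" using obtain_chart[OF atlas_G] .
  let ?i = "inv_into U \<phi>" and ?j = "inv_into V \<psi>"
  have der: "((\<lambda>x. F (?j x)) has_derivative (\<lambda>_. 0)) (at x)" if "x \<in> \<psi> ` V" for x
  proof -
    define h where "h = ?j x"
    have h: "h \<in> V" "\<psi> h = x" using that by (auto simp: h_def inv_into_into f_inv_into_f)
    \<comment> \<open>Right translation carries \<open>h\<close> to the unit, and k h^-1 acts on h u
      and h p as k does on u and p.\<close>
    let ?R = "\<lambda>k. k \<otimes>\<^bsub>G\<^esub> inv\<^bsub>G\<^esub> h"
    have R: "smooth_map AG AG ?R"
      by (intro smooth_map_mult smooth_map_const smooth_map_ident atlas_G)
    let ?N = "\<psi> ` (V \<inter> ?R -` U)"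
    have N: "open ?N" "x \<in> ?N"
      using h U(2)
      by (auto intro!: open_chart_image_Int[OF atlas_G V(1)]
          open_vimage[OF open_chart_domain[OF atlas_G U(1)] smooth_map_continuous[OF R]] image_eqI[of _ _ h])
    define c where "c = (\<lambda>y. \<phi> (?R (?j y)))"
    have cx: "c x = \<phi> \<one>\<^bsub>G\<^esub>" by (simp add: c_def h_def[symmetric])
    have "smooth_on ?N c" unfolding c_def by (rule smooth_mapD[OF R V(1) U(1)])
    then obtain c' where c': "(c has_derivative c') (at x)"
      using smooth_on_has_derivative N(2) by blast
    have "((\<lambda>y. D (act_fun G act (?i y) (act_fun G act h u)) (act (?i y) (act h p)))
        has_derivative (\<lambda>_. 0)) (at (c x))"
      unfolding cx by (rule has_derivative_conjugate_at_one[OF U D smooth_fun_act_fun[OF u] comm])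
    from diff_chain_at[OF c' this]
    have "((\<lambda>y. D (act_fun G act (?i (c y)) (act_fun G act h u)) (act (?i (c y)) (act h p)))
        has_derivative (\<lambda>_. 0)) (at x)"
      by (simp add: o_def)
    moreover have "D (act_fun G act (?i (c y)) (act_fun G act h u)) (act (?i (c y)) (act h p)) = F (?j y)"
      if "y \<in> ?N" for y
    proof -
      have "?i (c y) = ?R (?j y)"
        using that chart_inv[OF atlas_G U(1)] chart_inv[OF atlas_G V(1)] by (auto simp: c_def)
      then show ?thesis
        by (simp add: F_def act_fun_mult[symmetric] act_mult[symmetric] m_assoc)
    qed
    ultimately show ?thesis
      by (rule has_derivative_transform_within_open[OF _ N])
  qed
  obtain e where e: "e > 0" "ball (\<psi> g) e \<subseteq> \<psi> ` V"
    using open_chart_image[OF atlas_G V(1)] V(2) openE by blast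
  \<comment> \<open>A coordinate ball is connected, so a zero derivative there forces
    constancy.\<close>
  define W where "W = V \<inter> \<psi> -` ball (\<psi> g) e"
  have "F g = F h" if "h \<in> W" for h
  proof -
    have "F (?j (\<psi> g)) = F (?j (\<psi> h))"
      by (rule has_derivative_zero_unique_connected[OF open_ball connected_ball, of "\<psi> g" e "\<lambda>x. F (?j x)"])
        (use der e that in \<open>auto simp: W_def\<close>)
    then show ?thesis using chart_inv[OF atlas_G V(1)] that V(2) by (simp add: W_def)
  qed
  moreover have "open W"
    unfolding W_def by (intro continuous_open_preimage chart_continuous_on[OF atlas_G V(1)]
        open_chart_domain[OF atlas_G V(1)] open_ball)
  moreover have "g \<in> W" using V(2) e(1) by (simp add: W_def)
  ultimately have "eventually (\<lambda>h. F g = F h) (at g)"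
    unfolding eventually_at_topological by meson
  then show ?thesis unfolding F_def .
qed

lemma diff_op_act_fun:
  fixes u :: "'m \<Rightarrow> complex"
  assumes conn: "connected (UNIV :: 'g set)" and D: "diff_op AM D" and u: "smooth_fun AM u"
    and comm: "\<And>X f. X \<in> lie_algebra AG G \<Longrightarrow> smooth_fun AM f \<Longrightarrow>
      smooth_fun AM (inf_act G act X f) \<and> D (inf_act G act X f) = inf_act G act X (D f)"
  shows "D (act_fun G act g u) = act_fun G act g (D u)"
proof
  interpret group G by (rule group_G)
  fix q
  \<comment> \<open>With base point g^-1 q, the value at g is D (g u) at q, and the value at the
    unit is D u at g^-1 q, that is g (D u) at q.\<close>
  let ?F = "\<lambda>h. D (act_fun G act h u) (act h (act (inv\<^bsub>G\<^esub> g) q))"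
  have "?F g = ?F \<one>\<^bsub>G\<^esub>"
  proof (rule connected_local_const[OF conn UNIV_I UNIV_I], rule ballI)
    show "eventually (\<lambda>k. ?F h = ?F k) (at h)" for h
      by (rule conjugate_locally_constant[OF D u comm])
  qed
  then show "D (act_fun G act g u) q = act_fun G act g (D u) q"
    by (simp add: act_mult[symmetric] act_one act_fun_one) (simp add: act_fun_def)
qed

end

section \<open>Equivalences and quantum moment maps\<close>

lemma sum_fun_apply: "(\<Sum>i\<in>I. f i) p = (\<Sum>i\<in>I. f i p)"
  by (induction I rule: infinite_finite_induct) auto

lemma act_fun_sum:
  fixes f :: "'i \<Rightarrow> 'm \<Rightarrow> 'b::comm_monoid_add"
  shows "act_fun G act g (\<Sum>i\<in>I. f i) = (\<Sum>i\<in>I. act_fun G act g (f i))"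
  by (rule ext) (simp add: act_fun_def sum_fun_apply)

lemma smooth_fun_sum:
  assumes "smooth_atlas A" "\<And>i. i \<in> I \<Longrightarrow> smooth_fun A (f i)"
  shows "smooth_fun A (\<Sum>i\<in>I. f i)"
  using assms(2)
proof (induction I rule: infinite_finite_induct)
  case (insert i I)
  then show ?case using smooth_fun_add[OF assms(1), of "f i" "sum f I"] by (simp add: plus_fun_def)
qed (simp_all add: zero_fun_def smooth_fun_const)

lemma smooth_fun_zero: "smooth_fun A 0"
  by (simp add: zero_fun_def smooth_fun_const)

lemma formal_funsI: "(\<And>n. smooth_fun A (fps_nth u n)) \<Longrightarrow> u \<in> formal_funs A"
  and formal_funsD: "u \<in> formal_funs A \<Longrightarrow> smooth_fun A (fps_nth u n)"
  by (simp_all add: formal_funs_def)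

lemma formal_funs_diff:
  assumes "smooth_atlas A" "u \<in> formal_funs A" "v \<in> formal_funs A"
  shows "u - v \<in> formal_funs A"
proof (rule formal_funsI)
  fix n
  have "smooth_fun A (\<lambda>p. fps_nth u n p + - 1 * fps_nth v n p)"
    by (intro smooth_fun_add smooth_fun_mult smooth_fun_const assms formal_funsD)
  then show "smooth_fun A (fps_nth (u - v) n)"
    by (simp add: fun_diff_def)
qed

lemma formal_funs_const: "smooth_fun A f \<Longrightarrow> fps_const f \<in> formal_funs A"
  by (rule formal_funsI) (simp add: smooth_fun_zero)

lemma nth_cscale_X: "fps_nth (cscale fps_X u) n = (if n = 0 then 0 else fps_nth u (n - 1))"
proof -
  have "fps_nth (cscale fps_X u) n = (\<Sum>i\<le>n. if i = 1 then fps_nth u (n - 1) else 0)"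
    unfolding fps_scale_def fps_nth_Abs_fps
    by (rule sum.cong) (auto simp: fun_scale_def fps_X_def zero_fun_def)
  then show ?thesis by auto
qed

lemma nth_op_apply: "fps_nth (op_apply T u) n = (\<Sum>i\<le>n. T i (fps_nth u (n - i)))"
  by (simp add: op_apply_def)

section \<open>Operator series acting on formal functions\<close>

locale equivalence =
  fixes A :: "('m::{t2_space, second_countable_topology}, 'e::euclidean_space) atlas"
    and star star' :: "'m product" and T :: "'m op_series"
  assumes atlas: "smooth_atlas A" and equiv: "star_equivalence A star star' T"
begin

lemma op_zero: "smooth_fun A f \<Longrightarrow> T 0 f = f"
  and op_diff_op: "n > 0 \<Longrightarrow> diff_op A (T n)"
  using equiv unfolding star_equivalence_def by auto

lemma op_smooth: "smooth_fun A f \<Longrightarrow> smooth_fun A (T n f)"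
  using op_zero op_diff_op diff_op_smooth[OF atlas] by (cases "n = 0") auto

text \<open>\<open>star_equivalence\<close> describes \<open>T 0\<close> only by its values on
  smooth functions and calls \<open>T n\<close> a differential operator only for positive
  \<open>n\<close>, hence the two cases.\<close>

lemma op_add:
  assumes "smooth_fun A f" "smooth_fun A g"
  shows "T n (f + g) = T n f + T n g"
proof (cases "n = 0")
  case True
  then show ?thesis
    using assms smooth_fun_add[OF atlas assms] by (simp add: op_zero plus_fun_def)
next
  case False
  then show ?thesis
    using diff_op_add[OF atlas op_diff_op assms] by (simp add: plus_fun_def)
qed

lemma op_null: "T n 0 = 0"
  using op_add[of 0 0 n] smooth_fun_zero[of A] by simp

lemma op_apply_formal_funs:
  assumes "u \<in> formal_funs A" shows "op_apply T u \<in> formal_funs A"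
  by (rule formal_funsI)
    (use assms in \<open>auto simp: nth_op_apply intro!: smooth_fun_sum atlas op_smooth formal_funsD\<close>)

lemma op_apply_add:
  assumes "u \<in> formal_funs A" "v \<in> formal_funs A"
  shows "op_apply T (u + v) = op_apply T u + op_apply T v"
  by (rule fps_ext) (simp add: nth_op_apply op_add formal_funsD[OF assms(1)] formal_funsD[OF assms(2)] sum.distrib)

text \<open>The series starts with the identity, so the coefficient of order n of the image is that
  of the argument plus a correction from lower orders, and the argument is recovered recursively.
  This gives meaning to the \<open>inv_into\<close> in \<open>star_equivalence\<close>.\<close>

lemma op_apply_inj_on: "inj_on (op_apply T) (formal_funs A)"
proof (rule inj_onI, rule fps_ext)
  fix u v n assume uv: "u \<in> formal_funs A" "v \<in> formal_funs A" and eq: "op_apply T u = op_apply T v"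
  show "fps_nth u n = fps_nth v n"
  proof (induction n rule: less_induct)
    case (less n)
    have split: "fps_nth (op_apply T w) n = fps_nth w n + (\<Sum>i\<in>{1..n}. T i (fps_nth w (n - i)))"
      if "w \<in> formal_funs A" for w
    proof -
      have "{..n} = insert 0 {1..n}" by auto
      then show ?thesis using formal_funsD[OF that] by (simp add: nth_op_apply op_zero)
    qed
    have "(\<Sum>i\<in>{1..n}. T i (fps_nth u (n - i))) = (\<Sum>i\<in>{1..n}. T i (fps_nth v (n - i)))"
      by (rule sum.cong) (auto simp: less)
    then show ?case using split[OF uv(1)] split[OF uv(2)] eq by simp
  qed
qed

text \<open>The defining identity is evaluated at images under \<open>op_apply T\<close>, where
  injectivity makes \<open>inv_into\<close> a genuine inverse.\<close>

lemma op_apply_star: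
  assumes "u \<in> formal_funs A" "v \<in> formal_funs A"
  shows "op_apply T (star u v) = star' (op_apply T u) (op_apply T v)"
proof -
  have "star' (op_apply T u) (op_apply T v) =
      op_apply T (star (inv_into (formal_funs A) (op_apply T) (op_apply T u))
                       (inv_into (formal_funs A) (op_apply T) (op_apply T v)))"
    using equiv op_apply_formal_funs[OF assms(1)] op_apply_formal_funs[OF assms(2)]
    unfolding star_equivalence_def by blast
  then show ?thesis using op_apply_inj_on assms by simp
qed

end

section \<open>Generators of the enveloping algebra and quantum moment maps\<close>

lemma lie_algebra_zero: "0 \<in> lie_algebra A G"
  unfolding lie_algebra_def vector_field_def tangent_space_def pushforward_def
  by (auto simp: zero_fun_def smooth_fun_const)

lemma U_gen_carrier: "X \<in> lie_algebra A G \<Longrightarrow> U_gen A G X \<in> carrier (U_lambda A G)"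
proof -
  assume X: "X \<in> lie_algebra A G"
  \<comment> \<open>The coefficients of positive order are the zero field, which therefore has to
    lie in the Lie algebra.\<close>
  then have "fps_const X \<in> formal_lie_algebra A G"
    by (simp add: formal_lie_algebra_def lie_algebra_zero)
  then have "word_elem [fps_const X] \<in> carrier (free_algebra (formal_lie_algebra A G))"
    by (auto simp: free_algebra_def word_elem_def)
  then show ?thesis
    unfolding U_gen_def U_class_def U_lambda_def env_class_def env_algebra_def FactRing_def A_RCOSETS_def'
    by auto
qed

lemma quantum_moment_map_formal_funs:
  assumes "quantum_moment_map AG G AM act star \<Phi>" "X \<in> lie_algebra AG G"
  shows "\<Phi> (U_gen AG G X) \<in> formal_funs AM"
  using assms U_gen_carrier[OF assms(2)]
  unfolding quantum_moment_map_def star_ring_def by (auto dest: ring_hom_closed)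

text \<open>\<open>fps_map\<close> also acts on the zero coefficients of \<open>fps_const f\<close>.
  Linearity in \<open>tangent_space\<close>, taken with both scalars 0, shows that they stay
  zero.\<close>

lemma inf_act_null:
  assumes "X \<in> lie_algebra AG G"
  shows "inf_act G act X 0 = 0"
proof -
  have "X \<one>\<^bsub>G\<^esub> \<in> tangent_space AG \<one>\<^bsub>G\<^esub>"
    using assms unfolding lie_algebra_def vector_field_def by blast
  then have "X \<one>\<^bsub>G\<^esub> (\<lambda>q. 0 * 0 + 0 * 0) = 0 * X \<one>\<^bsub>G\<^esub> (\<lambda>_. 0) + 0 * X \<one>\<^bsub>G\<^esub> (\<lambda>_. 0)"
    unfolding tangent_space_def using smooth_fun_const[of AG "0 :: real"] by blast
  then have "X \<one>\<^bsub>G\<^esub> (\<lambda>_. 0) = 0" by simp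
  then show ?thesis
    by (auto simp: inf_act_def act_fun_def cderiv_def zero_fun_def o_def zero_complex.code)
qed

text \<open>\<lambda> X f is a star commutator of two elements of N[[\<lambda>]], which is closed
  under the product, and X f is its coefficient of order 1.\<close>

lemma quantum_moment_map_smooth_inf_act:
  assumes A: "smooth_atlas AM" and star: "star_product AM \<omega> star"
    and qm: "quantum_moment_map AG G AM act star \<Phi>" and X: "X \<in> lie_algebra AG G"
    and f: "smooth_fun AM f"
  shows "smooth_fun AM (inf_act G act X f)"
proof -
  let ?u = "fps_const f" and ?J = "\<Phi> (U_gen AG G X)"
  have cl: "star v w \<in> formal_funs AM" if "v \<in> formal_funs AM" "w \<in> formal_funs AM" for v w
    using star that unfolding star_product_def by blast
  have u: "?u \<in> formal_funs AM" by (rule formal_funs_const[OF f])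
  note J = quantum_moment_map_formal_funs[OF qm X]
  have "star ?J ?u - star ?u ?J \<in> formal_funs AM"
    by (intro formal_funs_diff[OF A] cl u J)
  then have "cscale fps_X (fps_map (inf_act G act X) ?u) \<in> formal_funs AM"
    using qm X u unfolding quantum_moment_map_def by simp
  from formal_funsD[OF this, of 1] show ?thesis
    by (simp add: nth_cscale_X fps_map_def)
qed

context equivalence
begin

lemma op_commutes_inf_act:
  assumes star: "star_product A \<omega> star" and star': "star_product A \<omega> star'"
    and qm: "quantum_moment_map AG G A act star \<Phi>" and qm': "quantum_moment_map AG G A act star' \<Phi>'"
    and X: "X \<in> lie_algebra AG G" and T: "op_apply T (\<Phi> (U_gen AG G X)) = \<Phi>' (U_gen AG G X)"
    and f: "smooth_fun A f"
  shows "T n (inf_act G act X f) = inf_act G act X (T n f)"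
proof -
  let ?u = "fps_const f" and ?J = "\<Phi> (U_gen AG G X)" and ?J' = "\<Phi>' (U_gen AG G X)"
  let ?d = "\<lambda>u. cscale fps_X (fps_map (inf_act G act X) u)"
  have cl: "star v w \<in> formal_funs A" if "v \<in> formal_funs A" "w \<in> formal_funs A" for v w
    using star that unfolding star_product_def by blast
  have u: "?u \<in> formal_funs A" by (rule formal_funs_const[OF f])
  note J = quantum_moment_map_formal_funs[OF qm X]
  have d: "star ?J ?u - star ?u ?J = ?d ?u"
    using qm X u unfolding quantum_moment_map_def by blast
  then have "?d ?u \<in> formal_funs A"
    using formal_funs_diff[OF atlas cl[OF J u] cl[OF u J]] by simp
  \<comment> \<open>The commutator relation is rearranged into a sum so that additivity of
    \<open>op_apply T\<close> applies.\<close>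
  moreover have "star ?J ?u = ?d ?u + star ?u ?J" using d by (simp add: diff_eq_eq)
  ultimately have "op_apply T (star ?J ?u) = op_apply T (?d ?u) + op_apply T (star ?u ?J)"
    using op_apply_add cl[OF u J] by metis
  then have "op_apply T (?d ?u) = star' ?J' (op_apply T ?u) - star' (op_apply T ?u) ?J'"
    using op_apply_star[OF J u] op_apply_star[OF u J] T by simp
  also have "\<dots> = ?d (op_apply T ?u)"
    using qm' X op_apply_formal_funs[OF u] unfolding quantum_moment_map_def by blast
  \<comment> \<open>The factor \<lambda> shifts orders by one, so order n + 1 speaks about
    \<open>T n\<close>; as \<open>?u\<close> is a constant series, a single term of each convolution
    survives.\<close>
  finally have eq: "fps_nth (op_apply T (?d ?u)) (Suc n) = fps_nth (?d (op_apply T ?u)) (Suc n)"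
    by simp
  have "fps_nth (op_apply T (?d ?u)) (Suc n) =
      (\<Sum>i\<le>Suc n. if i = n then T n (inf_act G act X f) else 0)"
    unfolding nth_op_apply
    by (rule sum.cong) (auto simp: nth_cscale_X fps_map_def op_null inf_act_null[OF X] split: if_splits)
  also have "\<dots> = T n (inf_act G act X f)" by simp
  finally have l: "fps_nth (op_apply T (?d ?u)) (Suc n) = T n (inf_act G act X f)" .
  have "fps_nth (op_apply T ?u) n = (\<Sum>i\<le>n. if i = n then T n f else 0)"
    unfolding nth_op_apply by (rule sum.cong) (auto simp: op_null)
  then have "fps_nth (?d (op_apply T ?u)) (Suc n) = inf_act G act X (T n f)"
    by (simp add: nth_cscale_X fps_map_def)
  then show ?thesis using eq l by simp
qed

end

theorem proposition4:
  fixes AG :: "('g::{t2_space, second_countable_topology}, 'd::euclidean_space) atlas"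
    and G :: "'g monoid"
    and AM :: "('m::{t2_space, second_countable_topology}, 'e::euclidean_space) atlas"
    and \<omega> :: "'m two_form"
    and act :: "'g \<Rightarrow> 'm \<Rightarrow> 'm"
    and star star' :: "'m product"
    and \<Phi> \<Phi>' :: "'g env \<Rightarrow> ('m \<Rightarrow> complex) fps"
    and T :: "'m op_series"
  assumes "lie_group AG G"
    and "connected (UNIV :: 'g set)"
    and "hamiltonian_space AG G AM \<omega> act"
    and "star_product AM \<omega> star" and "invariant_product G AM act star"
    and "star_product AM \<omega> star'" and "invariant_product G AM act star'"
    and "quantum_moment_map AG G AM act star \<Phi>"
    and "quantum_moment_map AG G AM act star' \<Phi>'"
    and "star_equivalence AM star star' T"
    and "\<forall>X\<in>lie_algebra AG G. op_apply T (\<Phi> (U_gen AG G X)) = \<Phi>' (U_gen AG G X)"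
  shows "invariant_op G AM act T \<and> G_equivalent G AM act star star'"
proof -
  interpret lie_action AG G AM act
    using assms(1,3) by unfold_locales (auto simp: hamiltonian_space_def)
  interpret equivalence AM star star' T
    using atlas_M assms(10) by unfold_locales
  have comm: "smooth_fun AM (inf_act G act X f) \<and> T n (inf_act G act X f) = inf_act G act X (T n f)"
    if "X \<in> lie_algebra AG G" "smooth_fun AM f" for n X f
    using quantum_moment_map_smooth_inf_act[OF atlas_M assms(4,8) that]
      op_commutes_inf_act[OF assms(4,6,8,9) that(1) _ that(2)] assms(11) that(1) by blast
  have T_act: "T n (act_fun G act g f) = act_fun G act g (T n f)" if f: "smooth_fun AM f" for n g f
  \<comment> \<open>\<open>T 0\<close> is the identity on smooth functions only, so this case rests
    on the smoothness of g f.\<close>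
  proof (cases "n = 0")
    case True
    then show ?thesis using f smooth_fun_act_fun[OF f] by (simp add: op_zero)
  next
    case False
    then show ?thesis using diff_op_act_fun[OF assms(2) op_diff_op f comm] by simp
  qed
  have "op_apply T (act_fps G act g u) = act_fps G act g (op_apply T u)" if u: "u \<in> formal_funs AM" for g u
    by (rule fps_ext)
      (simp add: act_fps_def fps_map_def nth_op_apply T_act[OF formal_funsD[OF u]] act_fun_sum)
  then have "invariant_op G AM act T" unfolding invariant_op_def by blast
  then show ?thesis using assms(10) unfolding G_equivalent_def by blast
qed

end
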